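(* Let $r,s\ge1$ be integers, let $\Sigma$ be a finite set, and let $\boldsymbol{P}_A,\boldsymbol{P}_B$ be one-step transition matrices on $\Sigma$. Assume that $\boldsymbol{P}_A$ and $\boldsymbol{P}_B$ are irreducible and aperiodic, as are all $r+s$ cyclic permutations $\boldsymbol{P}:=\boldsymbol{P}_A^r\boldsymbol{P}_B^s$, $\boldsymbol{P}_A^{r-1}\boldsymbol{P}_B^s\boldsymbol{P}_A$, $\ldots$, $\boldsymbol{P}_B^s\boldsymbol{P}_A^r$, $\ldots$, $\boldsymbol{P}_B\boldsymbol{P}_A^r\boldsymbol{P}_B^{s-1}$ of $\boldsymbol{P}_A^r\boldsymbol{P}_B^s$. Let $w:\Sigma\times\Sigma\to\mathbf{R}$ be a function. Let $\{X_n\}_{n\ge0}$ be the time-inhomogeneous Markov chain in $\Sigma$, with arbitrary distribution of $X_0$, whose successive one-step transition matrices are $\boldsymbol{P}_A,\ldots,\boldsymbol{P}_A$ ($r$ times), $\boldsymbol{P}_B,\ldots,\boldsymbol{P}_B$ ($s$ times), $\boldsymbol{P}_A,\ldots,\boldsymbol{P}_A$ ($r$ times), $\boldsymbol{P}_B,\ldots,\boldsymbol{P}_B$ ($s$ times), and so on. Put $\xi_n:=w(X_{n-1},X_n)$ and $S_n:=\xi_1+\cdots+\xi_n$ for $n\ge1$, and let $\mu$ and $\sigma^2$ be the parameters defined in the context. Then $$\lim_{n\to\infty}n^{-1}\mathrm{E}[S_n]=\mu\quad\text{and}\quad\frac{S_n}{n}\to\mu\ \text{ a.s.},$$ and, if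 $\sigma^2>0$, $$\lim_{n\to\infty}n^{-1}\mathrm{Var}(S_n)=\sigma^2\quad\text{and}\quad\frac{S_n-n\mu}{\sqrt{n\sigma^2}}\to_d N(0,1).$$ If $\mu=0$ and $\sigma^2>0$, then $$-\infty=\liminf_{n\to\infty}S_n<\limsup_{n\to\infty}S_n=\infty\ \text{ a.s.}$$
   Context: Transition matrices have row sums 1. Let $\boldsymbol{\pi}$ be the unique stationary distribution (row vector) of $\boldsymbol{P}=\boldsymbol{P}_A^r\boldsymbol{P}_B^s$, let $\boldsymbol{\Pi}$ be the square matrix each of whose rows is $\boldsymbol{\pi}$, and let $\boldsymbol{Z}:=(\boldsymbol{I}-(\boldsymbol{P}-\boldsymbol{\Pi}))^{-1}$ be the fundamental matrix associated with $\boldsymbol{P}$. Let $\boldsymbol{P}_A'$ and $\boldsymbol{P}_A''$ be the matrices with $(i,j)$ entries $(\boldsymbol{P}_A)_{ij}w(i,j)$ and $(\boldsymbol{P}_A)_{ij}w(i,j)^2$, respectively; define $\boldsymbol{P}_B',\boldsymbol{P}_B''$ analogously from $\boldsymbol{P}_B$. Let $\boldsymbol{1}$ be the column vector of ones. Define $$\mu:=\frac1{r+s}\Big(\sum_{u=0}^{r-1}\boldsymbol{\pi}\boldsymbol{P}_A^u\boldsymbol{P}_A'\boldsymbol{1}+\sum_{v=0}^{s-1}\boldsymbol{\pi}\boldsymbol{P}_A^r\boldsymbol{P}_B^v\boldsymbol{P}_B'\boldsymbol{1}\Big),\qquad \sigma^2:=\frac1{r+s}(V+2K),$$ where $$\begin{aligned}V:={}&\sum_{u=0}^{r-1}\big[\boldsymbol{\pi}\boldsymbol{P}_A^u\boldsymbol{P}_A''\boldsymbol{1}-(\boldsymbol{\pi}\boldsymbol{P}_A^u\boldsymbol{P}_A'\boldsymbol{1})^2\big]+\sum_{v=0}^{s-1}\big[\boldsymbol{\pi}\boldsymbol{P}_A^r\boldsymbol{P}_B^v\boldsymbol{P}_B''\boldsymbol{1}-(\boldsymbol{\pi}\boldsymbol{P}_A^r\boldsymbol{P}_B^v\boldsymbol{P}_B'\boldsymbol{1})^2\big]\\&+2\sum_{0\le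 u<v\le r-1}\boldsymbol{\pi}\boldsymbol{P}_A^u\boldsymbol{P}_A'\big[\boldsymbol{P}_A^{v-u-1}-\boldsymbol{\Pi}\boldsymbol{P}_A^v\big]\boldsymbol{P}_A'\boldsymbol{1}\\&+2\sum_{u=0}^{r-1}\sum_{v=0}^{s-1}\boldsymbol{\pi}\boldsymbol{P}_A^u\boldsymbol{P}_A'\big[\boldsymbol{P}_A^{r-u-1}\boldsymbol{P}_B^v-\boldsymbol{\Pi}\boldsymbol{P}_A^r\boldsymbol{P}_B^v\big]\boldsymbol{P}_B'\boldsymbol{1}\\&+2\sum_{0\le u<v\le s-1}\boldsymbol{\pi}\boldsymbol{P}_A^r\boldsymbol{P}_B^u\boldsymbol{P}_B'\big[\boldsymbol{P}_B^{v-u-1}-\boldsymbol{\Pi}\boldsymbol{P}_A^r\boldsymbol{P}_B^v\big]\boldsymbol{P}_B'\boldsymbol{1}\end{aligned}$$ and $$\begin{aligned}K:={}&\sum_{u=0}^{r-1}\sum_{v=0}^{r-1}\boldsymbol{\pi}\boldsymbol{P}_A^u\boldsymbol{P}_A'\boldsymbol{P}_A^{r-u-1}\boldsymbol{P}_B^s(\boldsymbol{Z}-\boldsymbol{\Pi})\boldsymbol{P}_A^v\boldsymbol{P}_A'\boldsymbol{1}\\&+\sum_{u=0}^{r-1}\sum_{v=0}^{s-1}\boldsymbol{\pi}\boldsymbol{P}_A^u\boldsymbol{P}_A'\boldsymbol{P}_A^{r-u-1}\boldsymbol{P}_B^s(\boldsymbol{Z}-\boldsymbol{\Pi})\bolds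ymbol{P}_A^r\boldsymbol{P}_B^v\boldsymbol{P}_B'\boldsymbol{1}\\&+\sum_{u=0}^{s-1}\sum_{v=0}^{r-1}\boldsymbol{\pi}\boldsymbol{P}_A^r\boldsymbol{P}_B^u\boldsymbol{P}_B'\boldsymbol{P}_B^{s-u-1}(\boldsymbol{Z}-\boldsymbol{\Pi})\boldsymbol{P}_A^v\boldsymbol{P}_A'\boldsymbol{1}\\&+\sum_{u=0}^{s-1}\sum_{v=0}^{s-1}\boldsymbol{\pi}\boldsymbol{P}_A^r\boldsymbol{P}_B^u\boldsymbol{P}_B'\boldsymbol{P}_B^{s-u-1}(\boldsymbol{Z}-\boldsymbol{\Pi})\boldsymbol{P}_A^r\boldsymbol{P}_B^v\boldsymbol{P}_B'\boldsymbol{1}.\end{aligned}$$ (When $X_0$ has distribution $\boldsymbol{\pi}$ and $\eta_m:=\xi_{(m-1)(r+s)+1}+\cdots+\xi_{m(r+s)}$, $V=\mathrm{Var}(\eta_1)$ and $K=\sum_{m=1}^\infty\mathrm{Cov}(\eta_1,\eta_{m+1})$.) $\to_d$ denotes convergence in distribution. *)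

theory Defs
  imports "HOL-Probability.Probability"
begin

(* The type class instances on real^'n act componentwise: there, 1 is the all-ones vector, while
   the power operation of the class monoid_mult is the entrywise power. The power of a square
   matrix with respect to the matrix product is therefore defined separately. *)
primrec mpow :: "real^'n^'n \<Rightarrow> nat \<Rightarrow> real^'n^'n"  (infixr "^^^" 80) where
  "A ^^^ 0 = mat 1"
| "A ^^^ Suc n = A ** A ^^^ n"

definition stochastic :: "real^'n^'n \<Rightarrow> bool" where
  "stochastic A \<longleftrightarrow> (\<forall>i j. 0 \<le> A $ i $ j) \<and> (\<forall>i. (\<Sum>j\<in>UNIV. A $ i $ j) = 1)"

definition irreducible_matrix :: "real^'n^'n \<Rightarrow> bool" where
  "irreducible_matrix A \<longleftrightarrow> (\<forall>i j. \<exists>n. 0 < (A ^^^ n) $ i $ j)"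

definition period :: "real^'n^'n \<Rightarrow> 'n \<Rightarrow> nat" where
  "period A i = Gcd {n. 0 < n \<and> 0 < (A ^^^ n) $ i $ i}"

definition aperiodic :: "real^'n^'n \<Rightarrow> bool" where
  "aperiodic A \<longleftrightarrow> (\<forall>i. period A i = 1)"

definition is_stationary_distribution :: "real^'n^'n \<Rightarrow> real^'n \<Rightarrow> bool" where
  "is_stationary_distribution P p \<longleftrightarrow>
     (\<forall>i. 0 \<le> p $ i) \<and> (\<Sum>i\<in>UNIV. p $ i) = 1 \<and> p v* P = p"

definition stationary_distribution :: "real^'n^'n \<Rightarrow> real^'n" where
  "stationary_distribution P = (THE p. is_stationary_distribution P p)"

definition stationary_matrix :: "real^'n^'n \<Rightarrow> real^'n^'n" where
  "stationary_matrix P = (\<chi> i. stationary_distribution P)"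

definition fundamental_matrix :: "real^'n^'n \<Rightarrow> real^'n^'n" where
  "fundamental_matrix P = matrix_inv (mat 1 - (P - stationary_matrix P))"

(* weighted 1 w A and weighted 2 w A are the matrices written A' and A''. *)
definition weighted :: "nat \<Rightarrow> ('n \<Rightarrow> 'n \<Rightarrow> real) \<Rightarrow> real^'n^'n \<Rightarrow> real^'n^'n" where
  "weighted k w A = (\<chi> i j. A $ i $ j * w i j ^ k)"

(* The scalar p M 1 for a row vector p and the column vector 1 of ones. *)
definition row_form :: "real^'n \<Rightarrow> real^'n^'n \<Rightarrow> real" where
  "row_form p M = (p v* M) \<bullet> 1"

definition mean_param ::
  "nat \<Rightarrow> nat \<Rightarrow> real^'n^'n \<Rightarrow> real^'n^'n \<Rightarrow> ('n \<Rightarrow> 'n \<Rightarrow> real) \<Rightarrow> real" where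
  "mean_param r s PA PB w =
    (let \<pi> = stationary_distribution (PA ^^^ r ** PB ^^^ s);
         PA' = weighted 1 w PA;
         PB' = weighted 1 w PB
     in ((\<Sum>u<r. row_form \<pi> (PA ^^^ u ** PA'))
         + (\<Sum>v<s. row_form \<pi> (PA ^^^ r ** PB ^^^ v ** PB'))) / real (r + s))"

definition V_param ::
  "nat \<Rightarrow> nat \<Rightarrow> real^'n^'n \<Rightarrow> real^'n^'n \<Rightarrow> ('n \<Rightarrow> 'n \<Rightarrow> real) \<Rightarrow> real" where
  "V_param r s PA PB w =
    (let P = PA ^^^ r ** PB ^^^ s;
         \<pi> = stationary_distribution P;
         Pi_mat = stationary_matrix P;
         PA' = weighted 1 w PA;  PA'' = weighted 2 w PA;
         PB' = weighted 1 w PB;  PB'' = weighted 2 w PB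
     in (\<Sum>u<r. row_form \<pi> (PA ^^^ u ** PA'') - (row_form \<pi> (PA ^^^ u ** PA'))\<^sup>2)
        + (\<Sum>v<s. row_form \<pi> (PA ^^^ r ** PB ^^^ v ** PB'')
                  - (row_form \<pi> (PA ^^^ r ** PB ^^^ v ** PB'))\<^sup>2)
        + 2 * (\<Sum>v<r. \<Sum>u<v. row_form \<pi>
                (PA ^^^ u ** PA' ** (PA ^^^ (v - u - 1) - Pi_mat ** PA ^^^ v) ** PA'))
        + 2 * (\<Sum>u<r. \<Sum>v<s. row_form \<pi>
                (PA ^^^ u ** PA'
                 ** (PA ^^^ (r - u - 1) ** PB ^^^ v - Pi_mat ** PA ^^^ r ** PB ^^^ v) ** PB'))
        + 2 * (\<Sum>v<s. \<Sum>u<v. row_form \<pi>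
                (PA ^^^ r ** PB ^^^ u ** PB'
                 ** (PB ^^^ (v - u - 1) - Pi_mat ** PA ^^^ r ** PB ^^^ v) ** PB')))"

definition K_param ::
  "nat \<Rightarrow> nat \<Rightarrow> real^'n^'n \<Rightarrow> real^'n^'n \<Rightarrow> ('n \<Rightarrow> 'n \<Rightarrow> real) \<Rightarrow> real" where
  "K_param r s PA PB w =
    (let P = PA ^^^ r ** PB ^^^ s;
         \<pi> = stationary_distribution P;
         Pi_mat = stationary_matrix P;
         Z = fundamental_matrix P;
         PA' = weighted 1 w PA;
         PB' = weighted 1 w PB
     in (\<Sum>u<r. \<Sum>v<r. row_form \<pi>
           (PA ^^^ u ** PA' ** PA ^^^ (r - u - 1) ** PB ^^^ s ** (Z - Pi_mat)
            ** PA ^^^ v ** PA'))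
        + (\<Sum>u<r. \<Sum>v<s. row_form \<pi>
           (PA ^^^ u ** PA' ** PA ^^^ (r - u - 1) ** PB ^^^ s ** (Z - Pi_mat)
            ** PA ^^^ r ** PB ^^^ v ** PB'))
        + (\<Sum>u<s. \<Sum>v<r. row_form \<pi>
           (PA ^^^ r ** PB ^^^ u ** PB' ** PB ^^^ (s - u - 1) ** (Z - Pi_mat)
            ** PA ^^^ v ** PA'))
        + (\<Sum>u<s. \<Sum>v<s. row_form \<pi>
           (PA ^^^ r ** PB ^^^ u ** PB' ** PB ^^^ (s - u - 1) ** (Z - Pi_mat)
            ** PA ^^^ r ** PB ^^^ v ** PB')))"

definition var_param ::
  "nat \<Rightarrow> nat \<Rightarrow> real^'n^'n \<Rightarrow> real^'n^'n \<Rightarrow> ('n \<Rightarrow> 'n \<Rightarrow> real) \<Rightarrow> real" where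
  "var_param r s PA PB w = (V_param r s PA PB w + 2 * K_param r s PA PB w) / real (r + s)"

(* The transition matrix used for the step from time n to time n + 1. *)
definition pattern_matrix ::
  "nat \<Rightarrow> nat \<Rightarrow> real^'n^'n \<Rightarrow> real^'n^'n \<Rightarrow> nat \<Rightarrow> real^'n^'n" where
  "pattern_matrix r s PA PB n = (if n mod (r + s) < r then PA else PB)"

(* Time-inhomogeneous Markov chain, T n being the transition matrix from time n to time n + 1.
   The law of X 0 is unconstrained; x is a path of states of which x 0, ..., x (n + 1) are used. *)
definition markov_chain ::
  "'a measure \<Rightarrow> (nat \<Rightarrow> real^'n^'n) \<Rightarrow> (nat \<Rightarrow> 'a \<Rightarrow> 'n) \<Rightarrow> bool" where
  "markov_chain M T X \<longleftrightarrow>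
     (\<forall>n. X n \<in> measurable M (count_space UNIV)) \<and>
     (\<forall>n x. 0 < \<P>(\<omega> in M. \<forall>k\<le>n. X k \<omega> = x k) \<longrightarrow>
        \<P>(\<omega> in M. X (Suc n) \<omega> = x (Suc n) \<bar> \<forall>k\<le>n. X k \<omega> = x k)
          = T n $ x n $ x (Suc n))"

definition payoff :: "('n \<Rightarrow> 'n \<Rightarrow> real) \<Rightarrow> (nat \<Rightarrow> 'a \<Rightarrow> 'n) \<Rightarrow> nat \<Rightarrow> 'a \<Rightarrow> real" where
  "payoff w X n \<omega> = w (X (n - 1) \<omega>) (X n \<omega>)"

definition total_payoff :: "('n \<Rightarrow> 'n \<Rightarrow> real) \<Rightarrow> (nat \<Rightarrow> 'a \<Rightarrow> 'n) \<Rightarrow> nat \<Rightarrow> 'a \<Rightarrow> real" where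
  "total_payoff w X n \<omega> = (\<Sum>k=1..n. payoff w X k \<omega>)"

end

theory Submission
  imports Defs "HOL-Library.Discrete_Functions"
begin

text \<open>
  The fundamental matrix solves the Poisson equation
  \<open>h\<^sub>k = T\<^sub>k h\<^sub>k\<^sub>+\<^sub>1 + c\<^sub>k - m\<close> of the periodic chain, where \<open>c\<^sub>k\<close> is the expected payoff of step
  \<open>k\<close> and \<open>m\<close> its average. Hence \<open>U\<^sub>n = S\<^sub>n - n m + h\<^sub>n(X\<^sub>n)\<close> is a martingale with bounded increments that
  differs from \<open>S\<^sub>n - n m\<close> by a bounded term, and the average of its conditional variances \<open>v\<^sub>k(X\<^sub>k)\<close> under
  stationarity is the asymptotic variance. Solving the Poisson equation once more, now for
  \<open>v\<close> in place of \<open>c\<close>, gives a corrector \<open>g\<close> such that \<open>y\<^sub>k = E[exp(z U\<^sub>k) (1 + z\<^sup>2/2 g\<^sub>k(X\<^sub>k))]\<close>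
  satisfies \<open>y\<^sub>k\<^sub>+\<^sub>1 = (1 + z\<^sup>2/2 \<sigma>2) y\<^sub>k + O(z\<^sup>3)\<close>. For imaginary \<open>z\<close> this is the central limit
  theorem. For real \<open>z\<close>, restricted to the event that \<open>U\<close> has not yet exceeded a level \<open>a\<close>, it
  shows that this event has vanishing probability. The law of large numbers follows
  from the linear growth of \<open>E[U\<^sub>n\<^sup>2]\<close> along the squares.
\<close>

subsection \<open>Stochastic matrices and the fundamental matrix\<close>

text \<open>The conditional variances \<open>v\<^sub>k(X\<^sub>k)\<close> fluctuate with the state.
  The corrector \<open>g\<close> replaces them by the constant \<sigma>2 at every single step, so
  the recursion for \<open>y\<close> closes and no convergence of conditional variances has to be
  shown. The matrix of one full cycle decides whether the Poisson equation can be solved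
  periodically: \<open>Z - Pi\<close> provides a value at time 0 to which the backward recursion
  returns after one period. The same recursion explains the shape of the variance: \<open>h\<close>
  consists of the payoffs left in the current cycle, which lead to V, and of a term with
  \<open>Z - Pi\<close> for all later cycles, which leads to K. The central limit theorem alone
  would give unbounded paths only with positive probability, leaving a zero-one law to be supplied.
  The real exponential moment yields probability one at once: stopped at the level \<open>a\<close>,
  it is bounded because the overshoot is bounded, yet each step adds a fixed multiple of the part
  still below \<open>a\<close>. That part is therefore summable in time and tends to 0.\<close>

lemma stochastic_mult_one: "stochastic A \<Longrightarrow> A *v 1 = 1"
  by (simp add: stochastic_def vec_eq_iff matrix_vector_mult_def)

lemma row_form_eq_inner: "row_form p A = p \<bullet> (A *v 1)"
  by (simp add: row_form_def dot_lmul_matrix)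

lemma inner_one_right: "(p :: real^'n) \<bullet> 1 = (\<Sum>i\<in>UNIV. p $ i)"
  by (simp add: inner_vec_def)

lemma stochastic_mat_1: "stochastic (mat 1)"
  by (auto simp: stochastic_def mat_def)

lemma stochastic_mult:
  assumes "stochastic A" "stochastic B"
  shows "stochastic (A ** B)"
proof -
  have "(\<Sum>j\<in>UNIV. (A ** B) $ i $ j) = 1" for i
  proof -
    have "(A ** B) *v 1 = 1"
      using assms by (simp add: stochastic_mult_one flip: matrix_vector_mul_assoc)
    then show ?thesis
      by (simp add: vec_eq_iff matrix_vector_mult_def)
  qed
  moreover have "0 \<le> (A ** B) $ i $ j" for i j
    using assms by (auto simp: stochastic_def matrix_matrix_mult_def intro!: sum_nonneg)
  ultimately show ?thesis
    by (simp add: stochastic_def)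
qed

lemma stochastic_mpow: "stochastic A \<Longrightarrow> stochastic (A ^^^ n)"
  by (induction n) (simp_all add: stochastic_mat_1 stochastic_mult)

text \<open>Maximum principle: at a maximal entry \<open>i\<close> the weighted sum of the
  nonnegative gaps \<open>x $ i - x $ k\<close> vanishes for every power of \<open>P\<close>, and
  irreducibility gives each \<open>j\<close> positive weight in some power.\<close>

lemma harmonic_const:
  fixes P :: "real^'n^'n"
  assumes P: "stochastic P" "irreducible_matrix P" and h: "P *v x = x"
  obtains c where "x = c *\<^sub>R 1"
proof -
  have pow: "(P ^^^ n) *v x = x" for n
    by (induction n) (simp_all add: h flip: matrix_vector_mul_assoc)
  obtain i where i: "\<And>j. x $ j \<le> x $ i"
  proof -
    have "Max (range (($) x)) \<in> range (($) x)"
      by (rule Max_in) auto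
    then obtain i where "Max (range (($) x)) = x $ i"
      by (metis imageE)
    then show ?thesis
      by (intro that[of i]) (metis Max_ge finite_imageI finite rangeI)
  qed
  have "x $ j = x $ i" for j
  proof -
    obtain n where n: "0 < (P ^^^ n) $ i $ j"
      using P(2) by (auto simp: irreducible_matrix_def)
    have st: "stochastic (P ^^^ n)"
      by (rule stochastic_mpow[OF P(1)])
    have "(\<Sum>k\<in>UNIV. (P ^^^ n) $ i $ k * (x $ i - x $ k)) = x $ i - ((P ^^^ n) *v x) $ i"
      using st by (simp add: stochastic_def matrix_vector_mult_def right_diff_distrib sum_subtractf
          flip: sum_distrib_right)
    also have "\<dots> = 0"
      by (simp add: pow)
    finally have "\<forall>k\<in>UNIV. (P ^^^ n) $ i $ k * (x $ i - x $ k) = 0"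
      using st i by (subst (asm) sum_nonneg_eq_0_iff) (auto simp: stochastic_def)
    then show ?thesis
      using n by (metis UNIV_I eq_iff_diff_eq_0 less_irrefl mult_eq_0_iff)
  qed
  then have "x = (x $ i) *\<^sub>R 1"
    by (simp add: vec_eq_iff)
  then show ?thesis
    by (rule that)
qed

text \<open>\<open>mat 1 - P\<close> is singular because it kills \<open>1\<close>, hence so is its
  transpose, which gives a nonzero left fixed vector \<open>x\<close> of unknown signs. Its
  entrywise absolute value satisfies \<open>y \<le> y v* P\<close> with equal total mass on both
  sides, so it is invariant and can be normalised.\<close>

lemma stationary_exists:
  fixes P :: "real^'n^'n"
  assumes P: "stochastic P"
  obtains p where "is_stationary_distribution P p"
proof -
  have "(mat 1 - P) *v 1 = 0"
    using P by (simp add: stochastic_mult_one matrix_vector_mult_diff_rdistrib)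
  moreover have "(1 :: real^'n) \<noteq> 0"
    by (simp add: vec_eq_iff)
  ultimately have "\<not> invertible (mat 1 - P)"
    using matrix_left_invertible_ker[of "mat 1 - P"] by (auto simp: invertible_def)
  then have "\<not> invertible (transpose (mat 1 - P))"
    by (simp add: invertible_det_nz det_transpose)
  then obtain x where x: "transpose (mat 1 - P) *v x = 0" "x \<noteq> 0"
    using matrix_left_invertible_ker[of "transpose (mat 1 - P)"]
      invertible_left_inverse[of "transpose (mat 1 - P)"] by blast
  have "x v* (mat 1 - P) = x - x v* P"
    by (simp add: vector_matrix_mult_diff_rdistrib)
  with x have xP: "x v* P = x"
    by simp
  define y :: "real^'n" where "y = (\<chi> i. \<bar>x $ i\<bar>)"
  have le: "y $ j \<le> (y v* P) $ j" for j
  proof -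
    have "\<bar>x $ j\<bar> = \<bar>\<Sum>i\<in>UNIV. P $ i $ j * x $ i\<bar>"
      by (subst xP[symmetric]) (simp add: vector_matrix_mult_def mult.commute)
    also have "\<dots> \<le> (\<Sum>i\<in>UNIV. \<bar>P $ i $ j * x $ i\<bar>)"
      by (rule sum_abs)
    also have "\<dots> = (y v* P) $ j"
      using P by (simp add: vector_matrix_mult_def y_def abs_mult stochastic_def mult.commute)
    finally show ?thesis
      by (simp add: y_def)
  qed
  have "(y v* P) \<bullet> 1 = y \<bullet> 1"
    using P by (simp add: dot_lmul_matrix stochastic_mult_one)
  then have "(\<Sum>j\<in>UNIV. (y v* P) $ j - y $ j) = 0"
    by (simp add: sum_subtractf inner_one_right)
  then have yP: "y v* P = y"
    using le by (subst (asm) sum_nonneg_eq_0_iff) (auto simp: vec_eq_iff)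
  define c where "c = (\<Sum>i\<in>UNIV. y $ i)"
  have "c > 0"
  proof -
    obtain i where "x $ i \<noteq> 0"
      using x(2) by (auto simp: vec_eq_iff)
    then show ?thesis
      unfolding c_def by (intro sum_pos2[of _ i]) (auto simp: y_def)
  qed
  have "is_stationary_distribution P ((1 / c) *\<^sub>R y)"
    unfolding is_stationary_distribution_def
  proof (intro conjI allI)
    show "((1 / c) *\<^sub>R y) v* P = (1 / c) *\<^sub>R y"
    proof -
      have "((1 / c) *\<^sub>R y) v* P = (1 / c) *\<^sub>R (y v* P)"
        by (simp add: vec_eq_iff vector_matrix_mult_def sum_distrib_left mult_ac)
      then show ?thesis
        by (simp add: yP)
    qed
    show "0 \<le> ((1 / c) *\<^sub>R y) $ i" for i
      using \<open>c > 0\<close> by (simp add: y_def)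
    show "(\<Sum>i\<in>UNIV. ((1 / c) *\<^sub>R y) $ i) = 1"
      using \<open>c > 0\<close> by (simp add: c_def flip: sum_divide_distrib)
  qed
  then show ?thesis
    by (rule that)
qed

text \<open>Pairing with \<open>p\<close> removes \<open>x - P *v x\<close> and leaves
  \<open>p \<bullet> x = 0\<close>; then \<open>x\<close> is harmonic, hence constant, hence 0. This
  is the injectivity of \<open>I - P + Pi\<close> behind both uniqueness of \<open>p\<close> and
  existence of Z.\<close>

lemma ker_stationary_perturbation:
  fixes P :: "real^'n^'n"
  assumes P: "stochastic P" "irreducible_matrix P" and p: "is_stationary_distribution P p"
    and x: "x - P *v x + (p \<bullet> x) *\<^sub>R 1 = 0"
  shows "x = 0"
proof -
  have p1: "p \<bullet> 1 = 1" and pP: "p \<bullet> (P *v y) = p \<bullet> y" for y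
    using p by (simp_all add: is_stationary_distribution_def inner_one_right flip: dot_lmul_matrix)
  have "p \<bullet> (x - P *v x + (p \<bullet> x) *\<^sub>R 1) = p \<bullet> x"
    by (simp add: inner_add_right inner_diff_right pP p1)
  then have "p \<bullet> x = 0"
    by (simp add: x)
  with x have "P *v x = x"
    by simp
  then obtain c where "x = c *\<^sub>R 1"
    using harmonic_const[OF P] by blast
  with \<open>p \<bullet> x = 0\<close> p1 show ?thesis
    by simp
qed

text \<open>The difference of two stationary distributions is annihilated from the left by the
  invertible matrix \<open>I - P + Pi\<close>.\<close>

lemma stationary_unique:
  fixes P :: "real^'n^'n"
  assumes P: "stochastic P" "irreducible_matrix P"
    and p: "is_stationary_distribution P p" and q: "is_stationary_distribution P q"
  shows "p = q"
proof -
  define B where "B = mat 1 - P + (\<chi> i. p)"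
  have Bx: "B *v x = x - P *v x + (p \<bullet> x) *\<^sub>R 1" for x
    by (simp add: B_def matrix_vector_mult_add_rdistrib matrix_vector_mult_diff_rdistrib)
       (simp add: vec_eq_iff matrix_vector_mul_component)
  have "\<exists>C. C ** B = mat 1"
    unfolding matrix_left_invertible_ker Bx using ker_stationary_perturbation[OF P p] by blast
  then obtain C where C: "B ** C = mat 1"
    using matrix_left_right_inverse by blast
  have "(p - q) v* B = 0"
  proof -
    have "((p - q) v* B) \<bullet> x = 0" for x
    proof -
      have "p \<bullet> (P *v x) = p \<bullet> x" "q \<bullet> (P *v x) = q \<bullet> x" "p \<bullet> 1 = 1" "q \<bullet> 1 = 1"
        using p q
        by (simp_all add: is_stationary_distribution_def inner_one_right flip: dot_lmul_matrix)
      then show ?thesis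
        by (simp add: dot_lmul_matrix Bx inner_add_right inner_diff_right inner_diff_left)
    qed
    then show ?thesis
      by (metis inner_eq_zero_iff)
  qed
  then have "((p - q) v* B) v* C = 0"
    by simp
  then show ?thesis
    by (simp add: vector_matrix_mul_assoc C)
qed

lemma stationary_distribution_stationary:
  assumes "stochastic P" "irreducible_matrix P"
  shows "is_stationary_distribution P (stationary_distribution P)"
  unfolding stationary_distribution_def
  by (metis assms stationary_exists stationary_unique theI)

lemma stationary_matrix_mult: "stationary_matrix P *v x = (stationary_distribution P \<bullet> x) *\<^sub>R 1"
  by (simp add: stationary_matrix_def vec_eq_iff matrix_vector_mul_component)

lemma
  fixes P :: "real^'n^'n"
  assumes P: "stochastic P" "irreducible_matrix P"
  shows stationary_inner_one: "stationary_distribution P \<bullet> 1 = 1"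
    and stationary_inner_mult: "stationary_distribution P \<bullet> (P *v x) = stationary_distribution P \<bullet> x"
  using stationary_distribution_stationary[OF P]
  by (simp_all add: is_stationary_distribution_def inner_one_right flip: dot_lmul_matrix)

text \<open>On vectors of mean zero, Z inverts \<open>I - P\<close>. Subtracting Pi selects, among
  solutions that differ by constants, the one of mean zero.\<close>

lemma
  fixes P :: "real^'n^'n" and x :: "real^'n"
  assumes P: "stochastic P" "irreducible_matrix P"
  defines "p \<equiv> stationary_distribution P"
    and "f \<equiv> (fundamental_matrix P - stationary_matrix P) *v x"
  shows fundamental_matrix_solves: "f - P *v f = x - (p \<bullet> x) *\<^sub>R 1"
    and stationary_inner_fundamental: "p \<bullet> f = 0"
proof -
  define B where "B = mat 1 - (P - stationary_matrix P)"
  have Bx: "B *v x = x - P *v x + (p \<bullet> x) *\<^sub>R 1" for x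
    by (simp add: B_def p_def matrix_vector_mult_diff_rdistrib stationary_matrix_mult)
  have "\<exists>C. C ** B = mat 1"
    unfolding matrix_left_invertible_ker Bx p_def
    using ker_stationary_perturbation[OF P stationary_distribution_stationary[OF P]] by blast
  then have "invertible B"
    by (simp add: invertible_left_inverse)
  then have "B ** matrix_inv B = mat 1"
    by (auto simp: invertible_def matrix_inv_def intro: someI2_ex)
  then have inv: "B ** fundamental_matrix P = mat 1"
    by (simp add: fundamental_matrix_def B_def)
  define y where "y = fundamental_matrix P *v x"
  have y: "y - P *v y + (p \<bullet> y) *\<^sub>R 1 = x"
    unfolding Bx[symmetric] by (simp add: y_def matrix_vector_mul_assoc inv)
  have p: "p \<bullet> 1 = 1" "p \<bullet> (P *v z) = p \<bullet> z" for z
    using P by (simp_all add: p_def stationary_inner_one stationary_inner_mult)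
  have "p \<bullet> x = p \<bullet> y"
    by (subst y[symmetric]) (simp add: inner_add_right inner_diff_right p)
  moreover have f: "f = y - (p \<bullet> x) *\<^sub>R 1"
    by (simp add: f_def y_def p_def matrix_vector_mult_diff_rdistrib stationary_matrix_mult)
  ultimately show "p \<bullet> f = 0"
    by (simp add: inner_diff_right p)
  have "P *v f = P *v y - (p \<bullet> x) *\<^sub>R 1"
    by (simp add: f matrix_vector_mult_diff_distrib matrix_vector_mult_scaleR stochastic_mult_one[OF P(1)])
  then have "f - P *v f = y - P *v y"
    by (simp add: f)
  also have "\<dots> = x - (p \<bullet> x) *\<^sub>R 1"
    using y \<open>p \<bullet> x = p \<bullet> y\<close> by (simp add: algebra_simps)
  finally show "f - P *v f = x - (p \<bullet> x) *\<^sub>R 1" .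
qed

subsection \<open>The Poisson equation of a periodic kernel\<close>

text \<open>The transition matrix from time \<open>a\<close> to time \<open>a + n\<close>. Peeling
  off the first factor matches the Poisson equation, which conditions on the first step.\<close>

primrec kernel_prod :: "(nat \<Rightarrow> real^'n^'n) \<Rightarrow> nat \<Rightarrow> nat \<Rightarrow> real^'n^'n" where
  "kernel_prod T a 0 = mat 1"
| "kernel_prod T a (Suc n) = T a ** kernel_prod T (Suc a) n"

lemma kernel_prod_add: "kernel_prod T a (m + n) = kernel_prod T a m ** kernel_prod T (a + m) n"
  by (induction m arbitrary: a) (simp_all add: matrix_mul_assoc)

lemma stochastic_kernel_prod: "(\<And>k. stochastic (T k)) \<Longrightarrow> stochastic (kernel_prod T a n)"
  by (induction n arbitrary: a) (simp_all add: stochastic_mat_1 stochastic_mult)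

lemma kernel_prod_const: "(\<And>k. k < n \<Longrightarrow> T (a + k) = A) \<Longrightarrow> kernel_prod T a n = A ^^^ n"
proof (induction n arbitrary: a)
  case (Suc n)
  have "kernel_prod T (Suc a) n = A ^^^ n"
  proof (rule Suc.IH)
    show "T (Suc a + k) = A" if "k < n" for k
      using Suc.prems[of "Suc k"] that by simp
  qed
  then show ?case
    using Suc.prems[of 0] by simp
qed simp

lemma periodic_mod:
  fixes f :: "nat \<Rightarrow> 'b"
  assumes "\<And>k. f (k + N) = f k"
  shows "f (k mod N) = f k"
proof -
  have "f (j + q * N) = f j" for j q
  proof (induction q)
    case (Suc q)
    then show ?case
      using assms[of "j + q * N"] by (simp add: ac_simps)
  qed simp
  from this[of "k mod N" "k div N"] show ?thesis
    by simp
qed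

lemma periodic_bounded:
  fixes f :: "nat \<Rightarrow> 'b::finite \<Rightarrow> real"
  assumes per: "\<And>k. f (k + N) = f k" and N: "0 < N"
  obtains C where "0 < C" "\<And>k i. \<bar>f k i\<bar> \<le> C"
proof -
  define C where "C = 1 + (\<Sum>k<N. \<Sum>i\<in>UNIV. \<bar>f k i\<bar>)"
  have "\<bar>f k i\<bar> \<le> C" for k i
  proof -
    have "\<bar>f k i\<bar> = \<bar>f (k mod N) i\<bar>"
      using periodic_mod[of f N k] per by simp
    also have "\<dots> \<le> (\<Sum>i\<in>UNIV. \<bar>f (k mod N) i\<bar>)"
      by (rule member_le_sum) auto
    also have "\<dots> \<le> (\<Sum>k<N. \<Sum>i\<in>UNIV. \<bar>f k i\<bar>)"
      using N by (intro member_le_sum[of _ _ "\<lambda>k. \<Sum>i\<in>UNIV. \<bar>f k i\<bar>"]) (auto intro: sum_nonneg)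
    finally show ?thesis
      by (simp add: C_def)
  qed
  moreover have "0 < C"
    unfolding C_def by (intro add_pos_nonneg sum_nonneg) auto
  ultimately show ?thesis
    using that by blast
qed

lemma sum_tail_sums: "(\<Sum>k<n. \<Sum>v=k..<n. f v) = (\<Sum>v<n. (real v + 1) * f v)"
proof (induction n)
  case (Suc n)
  have "(\<Sum>k<Suc n. \<Sum>v=k..<Suc n. f v) = (\<Sum>k<n. \<Sum>v=k..<Suc n. f v) + f n"
    by simp
  also have "(\<Sum>k<n. \<Sum>v=k..<Suc n. f v) = (\<Sum>k<n. (\<Sum>v=k..<n. f v) + f n)"
    by (intro sum.cong) auto
  finally show ?case
    by (simp add: Suc.IH sum.distrib algebra_simps)
qed simp

lemma square_sum_split:
  fixes f :: "nat \<Rightarrow> real"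
  shows "(\<Sum>k<n. f k)\<^sup>2 = (\<Sum>k<n. (f k)\<^sup>2) + 2 * (\<Sum>v<n. \<Sum>u<v. f u * f v)"
proof (induction n)
  case (Suc n)
  then show ?case
    by (simp add: power2_sum algebra_simps sum_distrib_left)
qed simp

lemma sum_lower_upper: "(\<Sum>u<n. \<Sum>v=Suc u..<n. f u v) = (\<Sum>v<n. \<Sum>u<v. (f u v :: real))"
proof (induction n)
  case (Suc n)
  have "(\<Sum>u<Suc n. \<Sum>v=Suc u..<Suc n. f u v) = (\<Sum>u<n. \<Sum>v=Suc u..<Suc n. f u v)"
    by simp
  also have "\<dots> = (\<Sum>u<n. (\<Sum>v=Suc u..<n. f u v) + f u n)"
    by (intro sum.cong) auto
  finally show ?case
    by (simp add: Suc.IH sum.distrib)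
qed simp

locale periodic_kernel =
  fixes N :: nat and T :: "nat \<Rightarrow> real^'n^'n"
  assumes N_pos: "0 < N"
    and stoch: "stochastic (T k)"
    and per: "T (k + N) = T k"
    and irred: "irreducible_matrix (kernel_prod T 0 N)"
begin

abbreviation "R \<equiv> kernel_prod T"
abbreviation "P \<equiv> kernel_prod T 0 N"
abbreviation "\<pi> \<equiv> stationary_distribution P"
abbreviation "ZPi \<equiv> fundamental_matrix P - stationary_matrix P"

text \<open>The expectation of \<open>x\<close> at \<open>X k\<close> when the chain starts in the
  stationary distribution of the cycle matrix.\<close>

definition pmean :: "nat \<Rightarrow> real^'n \<Rightarrow> real" where
  "pmean k x = \<pi> \<bullet> (R 0 k *v x)"

definition avg :: "(nat \<Rightarrow> real^'n) \<Rightarrow> real" where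
  "avg c = (\<Sum>k<N. pmean k (c k)) / real N"

text \<open>The Poisson solution of the homogeneous chain sampled once per cycle, whose payoff is
  the expected payoff of the whole cycle.\<close>

definition poisson_init :: "(nat \<Rightarrow> real^'n) \<Rightarrow> real^'n" where
  "poisson_init c = ZPi *v (\<Sum>v<N. R 0 v *v c v)"

text \<open>The expected centred payoff from time \<open>k\<close> to the end of the cycle,
  continued there by \<open>poisson_init\<close>.\<close>

definition poisson_upto :: "(nat \<Rightarrow> real^'n) \<Rightarrow> nat \<Rightarrow> real^'n" where
  "poisson_upto c k =
     (\<Sum>v=k..<N. R k (v - k) *v (c v - avg c *\<^sub>R 1)) + R k (N - k) *v poisson_init c"

definition poisson :: "(nat \<Rightarrow> real^'n) \<Rightarrow> nat \<Rightarrow> real^'n" where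
  "poisson c k = poisson_upto c (k mod N)"

lemma stochP: "stochastic P"
  by (simp add: stochastic_kernel_prod stoch)

lemma R_one: "R a n *v 1 = 1"
  by (simp add: stochastic_mult_one stochastic_kernel_prod stoch)

lemma pmean_one: "pmean k 1 = 1"
  by (simp add: pmean_def R_one stationary_inner_one[OF stochP irred])

lemma pmean_add: "pmean k (x + y) = pmean k x + pmean k y"
  and pmean_diff: "pmean k (x - y) = pmean k x - pmean k y"
  and pmean_scaleR: "pmean k (a *\<^sub>R x) = a * pmean k x"
  and pmean_0: "pmean k 0 = 0"
  by (simp_all add: pmean_def inner_add_right inner_diff_right matrix_vector_right_distrib
      matrix_vector_mult_diff_distrib matrix_vector_mult_scaleR)

lemma pmean_sum: "pmean k (\<Sum>a\<in>A. f a) = (\<Sum>a\<in>A. pmean k (f a))"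
  by (induction A rule: infinite_finite_induct) (simp_all add: pmean_add pmean_0)

lemma pmean_R: "pmean k (R k n *v x) = pmean (k + n) x"
  using kernel_prod_add[of T 0 k n] by (simp add: pmean_def matrix_vector_mul_assoc)

lemma pmean_Suc: "pmean k (T k *v x) = pmean (Suc k) x"
  using pmean_R[of k 1] by simp

lemma pmean_N: "pmean N x = pmean 0 x"
  by (simp add: pmean_def stationary_inner_mult[OF stochP irred])

lemma pmean_poisson_init: "pmean 0 (poisson_init c) = 0"
  by (simp add: pmean_def poisson_init_def stationary_inner_fundamental[OF stochP irred])

lemma poisson_upto_Suc:
  assumes "k < N"
  shows "poisson_upto c k = T k *v poisson_upto c (Suc k) + c k - avg c *\<^sub>R 1"
proof -
  have *: "R k (v - k) *v x = T k *v (R (Suc k) (v - Suc k) *v x)" if "Suc k \<le> v" for v x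
    using that by (simp add: Suc_diff_Suc[symmetric] Suc_diff_le matrix_vector_mul_assoc)
  have "(\<Sum>v=k..<N. R k (v - k) *v (c v - avg c *\<^sub>R 1))
      = c k - avg c *\<^sub>R 1 + (\<Sum>v=Suc k..<N. R k (v - k) *v (c v - avg c *\<^sub>R 1))"
    using assms by (simp add: sum.atLeast_Suc_lessThan)
  also have "(\<Sum>v=Suc k..<N. R k (v - k) *v (c v - avg c *\<^sub>R 1))
      = (\<Sum>v=Suc k..<N. T k *v (R (Suc k) (v - Suc k) *v (c v - avg c *\<^sub>R 1)))"
    by (intro sum.cong refl *) auto
  also have "\<dots> = T k *v (\<Sum>v=Suc k..<N. R (Suc k) (v - Suc k) *v (c v - avg c *\<^sub>R 1))"
    by (rule linear_sum[OF matrix_vector_mul_linear, symmetric])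
  finally show ?thesis
    using assms * [of N] by (simp add: poisson_upto_def matrix_vector_right_distrib)
qed

lemma poisson_upto_N: "poisson_upto c N = poisson_init c"
  by (simp add: poisson_upto_def)

text \<open>This closes the cycle and is the reason for the choice of \<open>poisson_init\<close>:
  the increment of \<open>poisson_init\<close> under \<open>P\<close> is the centred cycle payoff,
  and its centring constant is that of the \<open>N\<close> single steps added up.\<close>

lemma poisson_upto_0: "poisson_upto c 0 = poisson_init c"
proof -
  let ?C = "\<Sum>v<N. R 0 v *v c v"
  have "\<pi> \<bullet> ?C = real N * avg c"
    using N_pos by (simp add: avg_def pmean_def inner_sum_right)
  then have e1: "poisson_init c - P *v poisson_init c = ?C - (real N * avg c) *\<^sub>R 1"
    unfolding poisson_init_def by (simp add: fundamental_matrix_solves[OF stochP irred])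
  have e2: "(\<Sum>v=0..<N. R 0 v *v (c v - avg c *\<^sub>R 1)) = ?C - (real N * avg c) *\<^sub>R 1"
    by (simp add: atLeast0LessThan matrix_vector_mult_diff_distrib matrix_vector_mult_scaleR R_one
        sum_subtractf sum_constant_scaleR vec_eq_iff of_nat_index)
  show ?thesis
    unfolding poisson_upto_def diff_zero e2 e1[symmetric] by simp
qed

lemma poisson_periodic: "poisson c (k + N) = poisson c k"
  by (simp add: poisson_def)

lemma poisson_eq_upto: "k \<le> N \<Longrightarrow> poisson c k = poisson_upto c k"
  by (cases "k = N") (simp_all add: poisson_def poisson_upto_N poisson_upto_0)

text \<open>Within a cycle this is \<open>poisson_upto_Suc\<close>. At the last step, where
  \<open>Suc k\<close> wraps around to 0, it rests on the agreement of \<open>poisson_upto\<close>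
  at 0 and at \<open>N\<close>.\<close>

lemma poisson_equation:
  assumes "\<And>k. c (k + N) = c k"
  shows "poisson c k = T k *v poisson c (Suc k) + c k - avg c *\<^sub>R 1"
proof -
  have lt: "k mod N < N"
    using N_pos by simp
  have "poisson c k = poisson c (k mod N)" "poisson c (Suc k) = poisson c (Suc (k mod N))"
    by (simp_all add: poisson_def mod_Suc_eq)
  moreover have "c k = c (k mod N)" "T k = T (k mod N)"
    using periodic_mod[of c N k] periodic_mod[of T N k] assms per by simp_all
  ultimately show ?thesis
    using lt poisson_upto_Suc[OF lt, of c] poisson_eq_upto[of "k mod N" c]
      poisson_eq_upto[of "Suc (k mod N)" c] by simp
qed

subsection \<open>The asymptotic variance\<close>

definition drift :: "('n \<Rightarrow> 'n \<Rightarrow> real) \<Rightarrow> nat \<Rightarrow> real^'n" where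
  "drift w k = weighted 1 w (T k) *v 1"

text \<open>The increment of the martingale \<open>U\<close> when step \<open>k\<close> goes from
  \<open>i\<close> to \<open>j\<close>.\<close>

definition corrected :: "('n \<Rightarrow> 'n \<Rightarrow> real) \<Rightarrow> nat \<Rightarrow> 'n \<Rightarrow> 'n \<Rightarrow> real" where
  "corrected w k i j =
     w i j - avg (drift w) + poisson (drift w) (Suc k) $ j - poisson (drift w) k $ i"

text \<open>As the increments are centred, this is their conditional variance given
  \<open>X k = i\<close>.\<close>

definition dispersion :: "('n \<Rightarrow> 'n \<Rightarrow> real) \<Rightarrow> nat \<Rightarrow> real^'n" where
  "dispersion w k = (\<chi> i. \<Sum>j\<in>UNIV. T k $ i $ j * (corrected w k i j)\<^sup>2)"

lemma drift_periodic: "drift w (k + N) = drift w k"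
  by (simp add: drift_def per)

lemma corrected_periodic: "corrected w (k + N) = corrected w k"
  using poisson_periodic[of "drift w" k] poisson_periodic[of "drift w" "Suc k"]
  by (simp add: corrected_def fun_eq_iff)

lemma dispersion_periodic: "dispersion w (k + N) = dispersion w k"
  by (simp add: dispersion_def per corrected_periodic)

lemma T_row_sum: "(\<Sum>j\<in>UNIV. T k $ i $ j) = 1"
  using stoch by (simp add: stochastic_def)

lemma corrected_mean: "(\<Sum>j\<in>UNIV. T k $ i $ j * corrected w k i j) = 0"
proof -
  have "poisson (drift w) k $ i
      = (T k *v poisson (drift w) (Suc k)) $ i + drift w k $ i - avg (drift w)"
    by (subst poisson_equation[where c = "drift w", OF drift_periodic]) simp
  moreover have "(\<Sum>j\<in>UNIV. T k $ i $ j * corrected w k i j)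
      = drift w k $ i - avg (drift w) + (T k *v poisson (drift w) (Suc k)) $ i - poisson (drift w) k $ i"
    by (simp add: corrected_def matrix_vector_mult_def drift_def weighted_def ring_distribs
        sum.distrib sum_subtractf T_row_sum flip: sum_distrib_right)
  ultimately show ?thesis
    by simp
qed

text \<open>
  As the increments are centered, \<open>E[d\<^sup>2] = E[(w + h')\<^sup>2] - (m + h)\<^sup>2\<close>. Averaged over a period, the
  bracketed difference of squares telescopes.
\<close>

lemma dispersion_expand:
  "dispersion w k = weighted 2 w (T k) *v 1 + 2 *\<^sub>R (weighted 1 w (T k) *v poisson (drift w) (Suc k))
     + (T k *v (poisson (drift w) (Suc k))\<^sup>2 - (poisson (drift w) k)\<^sup>2)
     - (2 * avg (drift w)) *\<^sub>R poisson (drift w) k - (avg (drift w))\<^sup>2 *\<^sub>R 1"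
proof -
  let ?m = "avg (drift w)" and ?h = "poisson (drift w)"
  have "dispersion w k $ i = (\<Sum>j\<in>UNIV. T k $ i $ j * (w i j)\<^sup>2)
      + 2 * (\<Sum>j\<in>UNIV. T k $ i $ j * w i j * ?h (Suc k) $ j)
      + ((\<Sum>j\<in>UNIV. T k $ i $ j * (?h (Suc k) $ j)\<^sup>2) - (?h k $ i)\<^sup>2)
      - 2 * ?m * ?h k $ i - ?m\<^sup>2" (is "_ = ?r") for i
  proof -
    let ?b = "?m + ?h k $ i"
    have "dispersion w k $ i + 2 * ?b * (\<Sum>j\<in>UNIV. T k $ i $ j * corrected w k i j)
        = (\<Sum>j\<in>UNIV. T k $ i $ j * ((corrected w k i j)\<^sup>2 + 2 * ?b * corrected w k i j))"
      by (simp add: dispersion_def sum_distrib_left ring_distribs sum.distrib mult_ac)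
    also have "\<dots> = (\<Sum>j\<in>UNIV. T k $ i $ j * (w i j)\<^sup>2 + 2 * (T k $ i $ j * w i j * ?h (Suc k) $ j)
        + T k $ i $ j * (?h (Suc k) $ j)\<^sup>2 - T k $ i $ j * ?b\<^sup>2)"
      by (intro sum.cong refl) (simp add: corrected_def power2_eq_square algebra_simps)
    also have "\<dots> = ?r"
      by (simp add: sum.distrib sum_subtractf T_row_sum power2_sum flip: sum_distrib_left sum_distrib_right)
    finally show ?thesis
      by (simp add: corrected_mean)
  qed
  then show ?thesis
    by (simp add: vec_eq_iff matrix_vector_mult_def weighted_def power2_eq_square)
qed

text \<open>All covariances come from the cross term of \<open>dispersion_expand\<close>: in
  \<open>poisson (drift w) (Suc u)\<close> the remaining payoffs of the cycle produce the second
  sum, and the summand with \<open>ZPi\<close>, which accounts for all later cycles, produces the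
  third.\<close>

lemma avg_dispersion:
  "real N * avg (dispersion w) =
     (\<Sum>k<N. pmean k (weighted 2 w (T k) *v 1) - (pmean k (drift w k))\<^sup>2)
     + 2 * (\<Sum>v<N. \<Sum>u<v. pmean u (weighted 1 w (T u) *v (R (Suc u) (v - Suc u) *v drift w v))
              - pmean u (drift w u) * pmean v (drift w v))
     + 2 * (\<Sum>u<N. \<Sum>v<N. pmean u (weighted 1 w (T u)
              *v (R (Suc u) (N - Suc u) *v (ZPi *v (R 0 v *v drift w v)))))"
proof -
  let ?m = "avg (drift w)" and ?h = "poisson (drift w)"
  define \<rho> where "\<rho> k = pmean k (drift w k)" for k
  define A where "A u v = pmean u (weighted 1 w (T u) *v (R (Suc u) (v - Suc u) *v drift w v))" for u v
  define K where "K u = pmean u (weighted 1 w (T u) *v (R (Suc u) (N - Suc u) *v poisson_init (drift w)))" for u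
  have sum_\<rho>: "(\<Sum>k<N. \<rho> k) = real N * ?m"
    using N_pos by (simp add: avg_def \<rho>_def)
  have W1: "weighted (Suc 0) w (T k) *v 1 = drift w k" for k
    by (simp add: drift_def)
  have W: "pmean k (weighted 1 w (T k) *v ?h (Suc k))
      = (\<Sum>v=Suc k..<N. A k v - ?m * \<rho> k) + K k" if "k < N" for k
    using that
    by (simp add: poisson_eq_upto poisson_upto_def matrix_vector_right_distrib pmean_add K_def A_def
        linear_sum[OF matrix_vector_mul_linear] pmean_sum matrix_vector_mult_diff_distrib
        matrix_vector_mult_scaleR pmean_diff pmean_scaleR R_one W1 \<rho>_def)
  \<comment> \<open>The contribution of \<open>poisson_init\<close> vanishes: transported to the end
    of the cycle, it is the stationary mean of a vector of mean zero.\<close>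
  have H: "pmean k (?h k) = (\<Sum>v=k..<N. \<rho> v - ?m)" if "k < N" for k
    using that by (simp add: poisson_eq_upto poisson_upto_def pmean_add pmean_sum pmean_R pmean_N
        pmean_poisson_init pmean_diff pmean_scaleR pmean_one \<rho>_def)
  have tele: "(\<Sum>k<N. pmean (Suc k) ((?h (Suc k))\<^sup>2) - pmean k ((?h k)\<^sup>2)) = 0"
    using sum_lessThan_telescope[of "\<lambda>k. pmean k ((?h k)\<^sup>2)" N] poisson_periodic[of "drift w" 0]
    by (simp add: pmean_N)
  have "real N * avg (dispersion w) = (\<Sum>k<N. pmean k (dispersion w k))"
    using N_pos by (simp add: avg_def)
  also have "\<dots> = (\<Sum>k<N. pmean k (weighted 2 w (T k) *v 1))
      + 2 * (\<Sum>k<N. pmean k (weighted 1 w (T k) *v ?h (Suc k)))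
      - 2 * ?m * (\<Sum>k<N. pmean k (?h k)) - real N * ?m\<^sup>2"
    using tele by (simp add: dispersion_expand pmean_add pmean_diff pmean_scaleR pmean_one pmean_Suc
        sum.distrib sum_subtractf flip: sum_distrib_left)
  also have "(\<Sum>k<N. pmean k (weighted 1 w (T k) *v ?h (Suc k)))
      = (\<Sum>v<N. \<Sum>u<v. A u v) - ?m * (\<Sum>k<N. real (N - Suc k) * \<rho> k) + (\<Sum>k<N. K k)"
    by (simp add: W[unfolded One_nat_def] sum.distrib sum_subtractf sum_distrib_left mult_ac flip: sum_lower_upper)
  also have "(\<Sum>k<N. pmean k (?h k)) = (\<Sum>v<N. (real v + 1) * \<rho> v) - ?m * (\<Sum>v<N. (real v + 1))"
  proof -
    have "(\<Sum>k<N. pmean k (?h k)) = (\<Sum>k<N. \<Sum>v=k..<N. \<rho> v - ?m)"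
      by (simp add: H)
    also have "\<dots> = (\<Sum>v<N. (real v + 1) * (\<rho> v - ?m))"
      by (rule sum_tail_sums)
    finally show ?thesis
      by (simp add: right_diff_distrib sum_subtractf sum_distrib_left mult_ac)
  qed
  also have "(\<Sum>v<N. (real v + 1)) = real N * (real N + 1) / 2"
    by (induction N) (simp_all add: field_simps)
  also have "(\<Sum>k<N. real (N - Suc k) * \<rho> k) = real N * (real N * ?m) - (\<Sum>v<N. (real v + 1) * \<rho> v)"
    by (simp add: sum_\<rho>[symmetric] sum_distrib_left algebra_simps of_nat_diff flip: sum_subtractf)
  \<comment> \<open>The sums weighted by \<open>real v + 1\<close> cancel between the two centring
    contributions. What is left of them is the square of the mean cycle payoff, which
    \<open>square_sum_split\<close> distributes over the diagonal and the pairs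
    \<open>u < v\<close>.\<close>
  finally have *: "real N * avg (dispersion w) = (\<Sum>k<N. pmean k (weighted 2 w (T k) *v 1))
      + 2 * (\<Sum>v<N. \<Sum>u<v. A u v) + 2 * (\<Sum>k<N. K k) - (real N * ?m)\<^sup>2"
    by (simp add: field_simps power2_eq_square)
  have K: "K u = (\<Sum>v<N. pmean u (weighted 1 w (T u)
              *v (R (Suc u) (N - Suc u) *v (ZPi *v (R 0 v *v drift w v)))))" for u
    by (simp add: K_def poisson_init_def linear_sum[OF matrix_vector_mul_linear] pmean_sum)
  show ?thesis
    unfolding * sum_\<rho>[symmetric] square_sum_split[of \<rho>] K
    by (simp add: A_def \<rho>_def sum_subtractf algebra_simps)
qed

end

section \<open>Identification of the averages with the parameters of the two-matrix pattern\<close>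

lemma sum_lessThan_add:
  "(\<Sum>k<m + (n :: nat). f k) = (\<Sum>k<m. f k) + (\<Sum>k<n. (f (m + k) :: 'b::comm_monoid_add))"
  by (induction n) (simp_all add: ac_simps)

locale two_matrix_pattern =
  fixes r s :: nat and PA PB :: "real^'n^'n"
  assumes r_pos: "r \<ge> 1"
    and stochA: "stochastic PA" and stochB: "stochastic PB"
    and irredP: "irreducible_matrix (PA ^^^ r ** PB ^^^ s)"
begin

abbreviation "TT \<equiv> pattern_matrix r s PA PB"

lemma TT_A: "k < r \<Longrightarrow> TT k = PA"
  by (simp add: pattern_matrix_def)

lemma TT_B: "k < s \<Longrightarrow> TT (r + k) = PB"
  by (simp add: pattern_matrix_def)

lemma kernel_prod_A: "a + n \<le> r \<Longrightarrow> kernel_prod TT a n = PA ^^^ n"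
  by (intro kernel_prod_const TT_A) simp

lemma kernel_prod_B: "a + n \<le> s \<Longrightarrow> kernel_prod TT (r + a) n = PB ^^^ n"
  using TT_B by (intro kernel_prod_const) (simp add: add.assoc)

lemma kernel_prod_AB:
  assumes "a \<le> r" "v \<le> s"
  shows "kernel_prod TT a (r + v - a) = PA ^^^ (r - a) ** PB ^^^ v"
proof -
  have "kernel_prod TT a (r + v - a) = kernel_prod TT a ((r - a) + v)"
    using assms by simp
  also have "\<dots> = PA ^^^ (r - a) ** PB ^^^ v"
    using assms kernel_prod_A[of a "r - a"] kernel_prod_B[of 0 v]
    by (simp only: kernel_prod_add) simp
  finally show ?thesis .
qed

sublocale periodic_kernel "r + s" TT
proof
  show "irreducible_matrix (kernel_prod TT 0 (r + s))"
    using irredP kernel_prod_AB[of 0 s] by simp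
qed (use r_pos in \<open>auto simp: pattern_matrix_def stochA stochB\<close>)

lemma P_eq: "P = PA ^^^ r ** PB ^^^ s"
  using kernel_prod_AB[of 0 s] by simp

lemma R_A: "u \<le> r \<Longrightarrow> R 0 u = PA ^^^ u"
  by (simp add: kernel_prod_A)

lemma R_B: "v \<le> s \<Longrightarrow> R 0 (r + v) = PA ^^^ r ** PB ^^^ v"
  using kernel_prod_AB[of 0 v] by simp

lemma avg_drift_eq_mean_param: "avg (drift w) = mean_param r s PA PB w"
  unfolding avg_def mean_param_def Let_def row_form_eq_inner sum_lessThan_add P_eq[symmetric]
  by (simp add: pmean_def drift_def TT_A TT_B R_A R_B matrix_mul_assoc flip: matrix_vector_mul_assoc)

text \<open>Cutting the index range at \<open>r\<close> splits the sums of
  \<open>avg_dispersion\<close> into blocks. The pairs \<open>u < v\<close> leave three blocks for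
  V, since no B-step precedes an A-step within a cycle, while the unrestricted pairs give the four
  blocks of K.\<close>

lemma avg_dispersion_eq_var_param: "avg (dispersion w) = var_param r s PA PB w"
proof -
  let ?cA = "weighted 1 w PA *v 1" and ?cB = "weighted 1 w PB *v 1"
  have dA: "u < r \<Longrightarrow> drift w u = ?cA" and dB: "v < s \<Longrightarrow> drift w (r + v) = ?cB" for u v
    by (simp_all add: drift_def TT_A TT_B)
  have pA: "u \<le> r \<Longrightarrow> pmean u x = \<pi> \<bullet> (PA ^^^ u *v x)"
    and pB: "v \<le> s \<Longrightarrow> pmean (r + v) x = \<pi> \<bullet> (PA ^^^ r *v (PB ^^^ v *v x))" for u v x
    by (simp_all add: pmean_def R_A R_B flip: matrix_vector_mul_assoc)
  let ?F = "\<lambda>u v. pmean u (weighted 1 w (TT u) *v (R (Suc u) (v - Suc u) *v drift w v))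
              - pmean u (drift w u) * pmean v (drift w v)"
  let ?G = "\<lambda>u v. pmean u (weighted 1 w (TT u)
              *v (R (Suc u) (r + s - Suc u) *v (ZPi *v (R 0 v *v drift w v))))"
  \<comment> \<open>The matrix Pi collapses what follows it to a scalar multiple of
    \<open>1\<close>. This turns each bracket of V into a mixed moment minus a product of
    means.\<close>
  have Pi: "(X - stationary_matrix P ** Y) *v z = X *v z - (\<pi> \<bullet> (Y *v z)) *\<^sub>R 1" for X Y z
    by (simp add: matrix_vector_mult_diff_rdistrib stationary_matrix_mult flip: matrix_vector_mul_assoc)
  have Pi2: "(X - stationary_matrix P ** Y ** Y') *v z
      = X *v z - (\<pi> \<bullet> (Y *v (Y' *v z))) *\<^sub>R 1" for X Y Y' z
    by (simp add: matrix_vector_mult_diff_rdistrib stationary_matrix_mult flip: matrix_vector_mul_assoc)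
  note lin = matrix_vector_mult_diff_distrib matrix_vector_mult_scaleR inner_diff_right
    inner_scaleR_right
  note assoc = matrix_vector_mul_assoc[symmetric]
  have V1: "(\<Sum>k<r + s. pmean k (weighted 2 w (TT k) *v 1) - (pmean k (drift w k))\<^sup>2)
      = (\<Sum>u<r. row_form \<pi> (PA ^^^ u ** weighted 2 w PA) - (row_form \<pi> (PA ^^^ u ** weighted 1 w PA))\<^sup>2)
      + (\<Sum>v<s. row_form \<pi> (PA ^^^ r ** PB ^^^ v ** weighted 2 w PB)
           - (row_form \<pi> (PA ^^^ r ** PB ^^^ v ** weighted 1 w PB))\<^sup>2)"
    unfolding sum_lessThan_add row_form_eq_inner assoc
    by (simp add: pA pB dA dB TT_A TT_B)
  have V2: "(\<Sum>v<r. \<Sum>u<v. ?F u v) = (\<Sum>v<r. \<Sum>u<v. row_form \<pi>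
      (PA ^^^ u ** weighted 1 w PA ** (PA ^^^ (v - u - 1) - stationary_matrix P ** PA ^^^ v)
        ** weighted 1 w PA))"
    unfolding row_form_eq_inner assoc Pi lin
    by (intro sum.cong refl) (simp add: pA dA TT_A kernel_prod_A)
  have V3: "(\<Sum>v<s. \<Sum>u<r. ?F u (r + v)) = (\<Sum>u<r. \<Sum>v<s. row_form \<pi>
      (PA ^^^ u ** weighted 1 w PA ** (PA ^^^ (r - u - 1) ** PB ^^^ v
         - stationary_matrix P ** PA ^^^ r ** PB ^^^ v) ** weighted 1 w PB))"
    unfolding row_form_eq_inner assoc Pi2 lin
    by (subst sum.swap, intro sum.cong refl) (simp add: pA pB dA dB TT_A kernel_prod_AB assoc)
  have V4: "(\<Sum>v<s. \<Sum>u<v. ?F (r + u) (r + v)) = (\<Sum>v<s. \<Sum>u<v. row_form \<pi>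
      (PA ^^^ r ** PB ^^^ u ** weighted 1 w PB ** (PB ^^^ (v - u - 1)
         - stationary_matrix P ** PA ^^^ r ** PB ^^^ v) ** weighted 1 w PB))"
    unfolding row_form_eq_inner assoc Pi2 lin
    using kernel_prod_B[of "Suc _"]
    by (intro sum.cong refl) (simp add: pB dB TT_B)
  have "(\<Sum>v<r + s. \<Sum>u<v. ?F u v) = (\<Sum>v<r. \<Sum>u<v. ?F u v)
      + ((\<Sum>v<s. \<Sum>u<r. ?F u (r + v)) + (\<Sum>v<s. \<Sum>u<v. ?F (r + u) (r + v)))"
    unfolding sum_lessThan_add by (simp only: sum.distrib)
  note V234 = this[unfolded V2 V3 V4]
  have K: "(\<Sum>u<r + s. \<Sum>v<r + s. ?G u v) = K_param r s PA PB w"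
    unfolding sum_lessThan_add K_param_def Let_def row_form_eq_inner P_eq[symmetric] assoc sum.distrib
    using kernel_prod_B[of "Suc _" "s - Suc _"]
    by (simp add: pA pB dA dB TT_A TT_B R_A R_B kernel_prod_AB assoc)
  have "real (r + s) * avg (dispersion w) = V_param r s PA PB w + 2 * K_param r s PA PB w"
    unfolding avg_dispersion V1 V234 K
    by (simp only: V_param_def Let_def P_eq[symmetric] distrib_left add.assoc)
  then show ?thesis
    using r_pos by (simp add: var_param_def field_simps)
qed

end

subsection \<open>The Markov property for functions of the past\<close>

text \<open>Dependence on the trajectory up to time \<open>k\<close>, expressed by outcomes instead
  of a sigma-algebra. With finitely many states such an \<open>F\<close> takes finitely many values,
  so integrability and conditioning reduce to finite sums over paths.\<close>

definition adapted :: "(nat \<Rightarrow> 'a \<Rightarrow> 'n) \<Rightarrow> nat \<Rightarrow> ('a \<Rightarrow> 'b) \<Rightarrow> bool" where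
  "adapted X k F \<longleftrightarrow> (\<forall>\<omega> \<omega>'. (\<forall>i\<le>k. X i \<omega> = X i \<omega>') \<longrightarrow> F \<omega> = F \<omega>')"

lemma adaptedD: "adapted X k F \<Longrightarrow> (\<And>i. i \<le> k \<Longrightarrow> X i \<omega> = X i \<omega>') \<Longrightarrow> F \<omega> = F \<omega>'"
  by (simp add: adapted_def)

lemma adaptedI: "(\<And>\<omega> \<omega>'. (\<And>i. i \<le> k \<Longrightarrow> X i \<omega> = X i \<omega>') \<Longrightarrow> F \<omega> = F \<omega>') \<Longrightarrow> adapted X k F"
  unfolding adapted_def by blast

lemma adapted_mono: "adapted X k F \<Longrightarrow> k \<le> l \<Longrightarrow> adapted X l F"
  unfolding adapted_def by (meson order_trans)

lemma adapted_const [intro]: "adapted X k (\<lambda>_. c)"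
  by (simp add: adapted_def)

lemma adapted_state: "adapted X k (\<lambda>\<omega>. f (X k \<omega>))"
  by (simp add: adapted_def)

lemma adapted_comp: "adapted X k F \<Longrightarrow> adapted X k (\<lambda>\<omega>. f (F \<omega>))"
  unfolding adapted_def by metis

locale inhomogeneous_chain = prob_space M
  for M :: "'a measure" +
  fixes T :: "nat \<Rightarrow> real^'n^'n" and X :: "nat \<Rightarrow> 'a \<Rightarrow> 'n"
  assumes chain: "markov_chain M T X"
begin

definition cylinder :: "nat \<Rightarrow> (nat \<Rightarrow> 'n) \<Rightarrow> 'a set" where
  "cylinder k p = {\<omega> \<in> space M. \<forall>i\<le>k. X i \<omega> = p i}"

abbreviation paths :: "nat \<Rightarrow> (nat \<Rightarrow> 'n) set" where
  "paths k \<equiv> PiE {..k} (\<lambda>_. UNIV)"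

text \<open>For a path that no outcome follows, the choice is arbitrary but harmless, since the
  cylinder is then empty.\<close>

definition path_value :: "nat \<Rightarrow> ('a \<Rightarrow> 'b) \<Rightarrow> (nat \<Rightarrow> 'n) \<Rightarrow> 'b" where
  "path_value k F p = F (SOME \<omega>. \<forall>i\<le>k. X i \<omega> = p i)"

lemma X_measurable [measurable]: "X n \<in> measurable M (count_space UNIV)"
  using chain by (simp add: markov_chain_def)

lemma cylinder_sets [measurable]: "cylinder k p \<in> sets M"
  unfolding cylinder_def by measurable

lemma finite_paths: "finite (paths k)"
  by (intro finite_PiE) auto

lemma path_value_cylinder:
  assumes "adapted X k F" "\<omega> \<in> cylinder k p"
  shows "path_value k F p = F \<omega>"
proof -
  have "\<exists>\<omega>. \<forall>i\<le>k. X i \<omega> = p i"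
    using assms(2) by (auto simp: cylinder_def)
  then have "\<forall>i\<le>k. X i (SOME \<omega>. \<forall>i\<le>k. X i \<omega> = p i) = p i"
    by (rule someI_ex)
  then show ?thesis
    using assms(2) unfolding path_value_def
    by (intro adaptedD[OF assms(1)]) (simp add: cylinder_def)
qed

text \<open>The cylinders partition the space: elements of \<open>paths k\<close> are extensional,
  so the restricted trajectory of \<open>\<omega>\<close> is the only one whose cylinder contains
  \<open>\<omega>\<close>.\<close>

lemma cylinder_sum:
  fixes f :: "(nat \<Rightarrow> 'n) \<Rightarrow> 'b::real_vector"
  assumes "\<omega> \<in> space M" "\<And>p. \<omega> \<in> cylinder k p \<Longrightarrow> f p = x"
  shows "(\<Sum>p\<in>paths k. indicator (cylinder k p) \<omega> *\<^sub>R f p) = x"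
proof -
  let ?q = "restrict (\<lambda>i. X i \<omega>) {..k}"
  have q: "?q \<in> paths k" "\<omega> \<in> cylinder k ?q"
    using assms by (auto simp: cylinder_def)
  have uniq: "p = ?q" if "p \<in> paths k" "\<omega> \<in> cylinder k p" for p
    using that by (auto simp: cylinder_def PiE_iff extensional_def fun_eq_iff)
  have "(\<Sum>p\<in>paths k. indicator (cylinder k p) \<omega> *\<^sub>R f p) = (\<Sum>p\<in>paths k. if p = ?q then x else 0)"
  proof (intro sum.cong refl)
    fix p assume "p \<in> paths k"
    then have "\<omega> \<in> cylinder k p \<longleftrightarrow> p = ?q"
      using uniq q(2) by metis
    then show "indicator (cylinder k p) \<omega> *\<^sub>R f p = (if p = ?q then x else 0)"
      using assms(2)[of p] by (cases "p = ?q") simp_all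
  qed
  also have "\<dots> = x"
    using q finite_paths by simp
  finally show ?thesis .
qed

lemma has_integral_cylinders:
  fixes f :: "(nat \<Rightarrow> 'n) \<Rightarrow> 'b::{banach, second_countable_topology}"
  assumes "\<And>p \<omega>. \<omega> \<in> cylinder k p \<Longrightarrow> f p = F \<omega>"
  shows "has_bochner_integral M F (\<Sum>p\<in>paths k. prob (cylinder k p) *\<^sub>R f p)"
proof -
  have "has_bochner_integral M (\<lambda>\<omega>. \<Sum>p\<in>paths k. indicator (cylinder k p) \<omega> *\<^sub>R f p)
      (\<Sum>p\<in>paths k. prob (cylinder k p) *\<^sub>R f p)"
    by (intro has_bochner_integral_sum has_bochner_integral_indicator cylinder_sets)
      (simp add: less_top[symmetric])
  moreover have "(\<Sum>p\<in>paths k. indicator (cylinder k p) \<omega> *\<^sub>R f p) = F \<omega>" if "\<omega> \<in> space M" for \<omega>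
    using that assms by (rule cylinder_sum)
  ultimately show ?thesis
    by (simp cong: has_bochner_integral_cong)
qed

lemma adapted_has_integral:
  fixes F :: "'a \<Rightarrow> 'b::{banach, second_countable_topology}"
  assumes "adapted X k F"
  shows "has_bochner_integral M F (\<Sum>p\<in>paths k. prob (cylinder k p) *\<^sub>R path_value k F p)"
  by (rule has_integral_cylinders) (rule path_value_cylinder[OF assms])

lemma adapted_integrable:
  fixes F :: "'a \<Rightarrow> 'b::{banach, second_countable_topology}"
  shows "adapted X k F \<Longrightarrow> integrable M F"
  using adapted_has_integral by (auto simp: has_bochner_integral_iff)

text \<open>The product form also covers null cylinders, about which \<open>markov_chain\<close>
  says nothing; there both sides are 0.\<close>

lemma prob_cylinder_step:
  "prob (cylinder k p \<inter> {\<omega> \<in> space M. X (Suc k) \<omega> = j}) = prob (cylinder k p) * T k $ p k $ j"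
proof (cases "prob (cylinder k p) = 0")
  case True
  have "prob (cylinder k p \<inter> {\<omega> \<in> space M. X (Suc k) \<omega> = j}) \<le> prob (cylinder k p)"
    by (rule finite_measure_mono) auto
  with True show ?thesis
    by (simp add: measure_le_0_iff)
next
  case False
  define q where "q = p(Suc k := j)"
  have cyl: "cylinder k p = {\<omega> \<in> space M. \<forall>i\<le>k. X i \<omega> = q i}"
    by (auto simp: cylinder_def q_def)
  have "0 < \<P>(\<omega> in M. \<forall>i\<le>k. X i \<omega> = q i)"
    using False by (simp add: cyl zero_less_measure_iff)
  then have "\<P>(\<omega> in M. X (Suc k) \<omega> = q (Suc k) \<bar> \<forall>i\<le>k. X i \<omega> = q i) = T k $ q k $ q (Suc k)"
    using chain by (simp add: markov_chain_def)
  moreover have "{\<omega> \<in> space M. X (Suc k) \<omega> = q (Suc k) \<and> (\<forall>i\<le>k. X i \<omega> = q i)}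
      = cylinder k p \<inter> {\<omega> \<in> space M. X (Suc k) \<omega> = j}"
    by (auto simp: cylinder_def q_def)
  ultimately have "prob (cylinder k p \<inter> {\<omega> \<in> space M. X (Suc k) \<omega> = j}) / prob (cylinder k p)
      = T k $ q k $ q (Suc k)"
    by (simp only: cond_prob_def cyl)
  then show ?thesis
    using False by (simp add: q_def field_simps)
qed

text \<open>An integrated form of conditioning on the past: splitting over the finitely many pairs
  of a path and a next state reduces both expectations to the sum \<open>?I\<close>. Values in a
  Banach space allow real and complex exponentials alike.\<close>

lemma markov_step:
  fixes F :: "'a \<Rightarrow> 'n \<Rightarrow> 'b::{banach, second_countable_topology}"
  assumes F: "\<And>j. adapted X k (\<lambda>\<omega>. F \<omega> j)"
  shows "integrable M (\<lambda>\<omega>. F \<omega> (X (Suc k) \<omega>))"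
    and "expectation (\<lambda>\<omega>. F \<omega> (X (Suc k) \<omega>))
       = expectation (\<lambda>\<omega>. \<Sum>j\<in>UNIV. T k $ X k \<omega> $ j *\<^sub>R F \<omega> j)"
proof -
  let ?f = "\<lambda>j. path_value k (\<lambda>\<omega>. F \<omega> j)"
  let ?I = "\<Sum>p\<in>paths k. prob (cylinder k p) *\<^sub>R (\<Sum>j\<in>UNIV. T k $ p k $ j *\<^sub>R ?f j p)"
  have int: "has_bochner_integral M (\<lambda>\<omega>. \<Sum>j\<in>UNIV. \<Sum>p\<in>paths k.
       indicator (cylinder k p \<inter> {\<omega> \<in> space M. X (Suc k) \<omega> = j}) \<omega> *\<^sub>R ?f j p)
      (\<Sum>j\<in>UNIV. \<Sum>p\<in>paths k. prob (cylinder k p \<inter> {\<omega> \<in> space M. X (Suc k) \<omega> = j}) *\<^sub>R ?f j p)"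
    by (rule has_bochner_integral_sum, rule has_bochner_integral_sum, rule has_bochner_integral_indicator)
      (measurable, simp add: less_top[symmetric])
  have val: "(\<Sum>j\<in>UNIV. \<Sum>p\<in>paths k. prob (cylinder k p \<inter> {\<omega> \<in> space M. X (Suc k) \<omega> = j}) *\<^sub>R ?f j p) = ?I"
    unfolding prob_cylinder_step by (subst sum.swap) (simp add: scaleR_sum_right)
  have integrand: "(\<Sum>j\<in>UNIV. \<Sum>p\<in>paths k.
       indicator (cylinder k p \<inter> {\<omega> \<in> space M. X (Suc k) \<omega> = j}) \<omega> *\<^sub>R ?f j p) = F \<omega> (X (Suc k) \<omega>)"
    if \<omega>: "\<omega> \<in> space M" for \<omega>
  proof -
    have "(\<Sum>p\<in>paths k. indicator (cylinder k p \<inter> {\<omega> \<in> space M. X (Suc k) \<omega> = j}) \<omega> *\<^sub>R ?f j p)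
        = (if j = X (Suc k) \<omega> then F \<omega> j else 0)" for j
    proof -
      have "(\<Sum>p\<in>paths k. indicator (cylinder k p) \<omega> *\<^sub>R ?f j p) = F \<omega> j"
        using \<omega> by (rule cylinder_sum) (rule path_value_cylinder[OF F])
      then show ?thesis
        using \<omega> by (cases "j = X (Suc k) \<omega>") (simp_all add: indicator_inter_arith)
    qed
    then show ?thesis
      by simp
  qed
  have "has_bochner_integral M (\<lambda>\<omega>. F \<omega> (X (Suc k) \<omega>)) ?I"
    using has_bochner_integral_cong[THEN iffD1, OF refl integrand val int] .
  moreover have "has_bochner_integral M (\<lambda>\<omega>. \<Sum>j\<in>UNIV. T k $ X k \<omega> $ j *\<^sub>R F \<omega> j) ?I"
  proof (rule has_integral_cylinders)
    fix p \<omega> assume "\<omega> \<in> cylinder k p"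
    then show "(\<Sum>j\<in>UNIV. T k $ p k $ j *\<^sub>R ?f j p) = (\<Sum>j\<in>UNIV. T k $ X k \<omega> $ j *\<^sub>R F \<omega> j)"
      by (simp add: path_value_cylinder[OF F] cylinder_def)
  qed
  ultimately show "integrable M (\<lambda>\<omega>. F \<omega> (X (Suc k) \<omega>))"
    and "expectation (\<lambda>\<omega>. F \<omega> (X (Suc k) \<omega>))
       = expectation (\<lambda>\<omega>. \<Sum>j\<in>UNIV. T k $ X k \<omega> $ j *\<^sub>R F \<omega> j)"
    by (auto simp: has_bochner_integral_iff)
qed

end

subsection \<open>Additive functionals with bounded martingale increments\<close>

text \<open>The general field serves two uses: imaginary arguments for characteristic functions and
  real ones for unboundedness.\<close>

lemma exp_Taylor_2:
  fixes x :: "'b::{real_normed_field, banach}"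
  assumes "norm x \<le> a"
  shows "norm (exp x - (1 + x + x\<^sup>2 / 2)) \<le> exp a * a ^ 3 / 2"
proof -
  have "(\<Sum>i\<le>2. x ^ i / fact i) = 1 + x + x\<^sup>2 / 2"
    by (simp add: atMost_nat_numeral)
  then have "norm (exp x - (1 + x + x\<^sup>2 / 2)) \<le> exp (norm x) * norm x ^ 3 / 2"
    using Taylor_exp_field[of x 2] by (simp add: eval_nat_numeral)
  also have "\<dots> \<le> exp a * a ^ 3 / 2"
    using assms by (intro divide_right_mono mult_mono power_mono) auto
  finally show ?thesis .
qed

lemma exp_Taylor_0:
  fixes x :: "'b::{real_normed_field, banach}"
  assumes "norm x \<le> a"
  shows "norm (exp x - 1) \<le> exp a * a"
proof -
  have "norm (exp x - 1) \<le> exp (norm x) * norm x"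
    using Taylor_exp_field[of x 0] by simp
  also have "\<dots> \<le> exp a * a"
    using assms by (intro mult_mono) auto
  finally show ?thesis .
qed

text \<open>
  \<open>g\<close> is a corrector for the conditional variances: it solves their Poisson equation, so that
  \<open>U\<^sub>k\<^sup>2 + g\<^sub>k(X\<^sub>k) - k \<sigma>2\<close> is a martingale.
\<close>

locale corrected_walk = inhomogeneous_chain M T X
  for M :: "'a measure" and T :: "nat \<Rightarrow> real^'n^'n" and X :: "nat \<Rightarrow> 'a \<Rightarrow> 'n" +
  fixes U :: "nat \<Rightarrow> 'a \<Rightarrow> real" and d :: "nat \<Rightarrow> 'n \<Rightarrow> 'n \<Rightarrow> real"
    and g :: "nat \<Rightarrow> 'n \<Rightarrow> real" and \<sigma>2 C :: real
  assumes T_stochastic: "stochastic (T k)"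
    and U_adapted: "adapted X k (U k)"
    and U_Suc: "U (Suc k) \<omega> = U k \<omega> + d k (X k \<omega>) (X (Suc k) \<omega>)"
    and U_0: "\<bar>U 0 \<omega>\<bar> \<le> C"
    and d_bound: "\<bar>d k i j\<bar> \<le> C"
    and g_bound: "\<bar>g k i\<bar> \<le> C"
    and d_mean: "(\<Sum>j\<in>UNIV. T k $ i $ j * d k i j) = 0"
    and g_step: "(\<Sum>j\<in>UNIV. T k $ i $ j * ((d k i j)\<^sup>2 + g (Suc k) j)) = g k i + \<sigma>2"
begin

lemma C_nonneg: "0 \<le> C"
  using U_0[of undefined] by linarith

lemma T_nonneg: "0 \<le> T k $ i $ j" and T_sum: "(\<Sum>j\<in>UNIV. T k $ i $ j) = 1"
  using T_stochastic[of k] by (simp_all add: stochastic_def)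

text \<open>\<open>H\<close> makes room for further dependence on the past. It is the trivial
  \<open>()\<close> for moments and characteristic functions, and the indicator of not having
  exceeded a level in the proof of unboundedness.\<close>

lemma adapted_past:
  assumes "adapted X k H"
  shows "adapted X k (\<lambda>\<omega>. f (H \<omega>) (U k \<omega>) (X k \<omega>))"
proof (rule adaptedI)
  fix \<omega> \<omega>' assume *: "\<And>i. i \<le> k \<Longrightarrow> X i \<omega> = X i \<omega>'"
  have "H \<omega> = H \<omega>'" "U k \<omega> = U k \<omega>'" "X k \<omega> = X k \<omega>'"
    using adaptedD[OF assms *] adaptedD[OF U_adapted *] * by auto
  then show "f (H \<omega>) (U k \<omega>) (X k \<omega>) = f (H \<omega>') (U k \<omega>') (X k \<omega>')"
    by simp
qed

lemma integrable_past:
  fixes f :: "'h \<Rightarrow> real \<Rightarrow> 'n \<Rightarrow> 'b::{banach, second_countable_topology}"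
  shows "adapted X k H \<Longrightarrow> integrable M (\<lambda>\<omega>. f (H \<omega>) (U k \<omega>) (X k \<omega>))"
  by (rule adapted_integrable[OF adapted_past])

lemma expectation_step:
  fixes f :: "'h \<Rightarrow> real \<Rightarrow> 'n \<Rightarrow> 'b::{banach, second_countable_topology}"
  assumes "adapted X k H"
  shows "expectation (\<lambda>\<omega>. f (H \<omega>) (U (Suc k) \<omega>) (X (Suc k) \<omega>))
       = expectation (\<lambda>\<omega>. \<Sum>j\<in>UNIV. T k $ X k \<omega> $ j *\<^sub>R f (H \<omega>) (U k \<omega> + d k (X k \<omega>) j) j)"
  unfolding U_Suc
  by (rule markov_step(2)[where F = "\<lambda>\<omega> j. f (H \<omega>) (U k \<omega> + d k (X k \<omega>) j) j"])
     (rule adapted_past[OF assms, where f = "\<lambda>h u i. f h (u + d k i _) _"])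

lemma norm_expectation_le:
  fixes F :: "'a \<Rightarrow> 'b::{banach, second_countable_topology}"
  assumes "integrable M F" "\<And>\<omega>. norm (F \<omega>) \<le> c"
  shows "norm (expectation F) \<le> c"
proof -
  have "norm (expectation F) \<le> expectation (\<lambda>\<omega>. norm (F \<omega>))"
    by (rule integral_norm_bound)
  also have "\<dots> \<le> c"
    using assms by (intro integral_le_const) auto
  finally show ?thesis .
qed

lemma norm_kernel_le:
  fixes \<phi> :: "'n \<Rightarrow> 'b::real_normed_vector"
  assumes "\<And>j. norm (\<phi> j) \<le> c"
  shows "norm (\<Sum>j\<in>UNIV. T k $ i $ j *\<^sub>R \<phi> j) \<le> c"
proof -
  have "norm (\<Sum>j\<in>UNIV. T k $ i $ j *\<^sub>R \<phi> j) \<le> (\<Sum>j\<in>UNIV. T k $ i $ j * c)"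
    using assms T_nonneg by (intro sum_norm_le) (simp add: mult_left_mono)
  then show ?thesis
    by (simp add: T_sum flip: sum_distrib_right)
qed

lemma expectation_U: "expectation (U n) = expectation (U 0)"
proof (induction n)
  case (Suc n)
  have "expectation (U (Suc n)) = expectation (\<lambda>\<omega>. \<Sum>j\<in>UNIV. T n $ X n \<omega> $ j *\<^sub>R (U n \<omega> + d n (X n \<omega>) j))"
    by (rule expectation_step[where f = "\<lambda>_ u _. u" and H = "\<lambda>_. ()", OF adapted_const])
  also have "\<dots> = expectation (U n)"
    by (simp add: ring_distribs sum.distrib d_mean T_sum flip: sum_distrib_right)
  finally show ?case
    using Suc by simp
qed simp

lemma second_moment_step:
  "expectation (\<lambda>\<omega>. (U n \<omega>)\<^sup>2 + g n (X n \<omega>))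
     = expectation (\<lambda>\<omega>. (U 0 \<omega>)\<^sup>2 + g 0 (X 0 \<omega>)) + real n * \<sigma>2"
proof (induction n)
  case (Suc n)
  have "expectation (\<lambda>\<omega>. (U (Suc n) \<omega>)\<^sup>2 + g (Suc n) (X (Suc n) \<omega>))
      = expectation (\<lambda>\<omega>. \<Sum>j\<in>UNIV. T n $ X n \<omega> $ j *\<^sub>R ((U n \<omega> + d n (X n \<omega>) j)\<^sup>2 + g (Suc n) j))"
    by (rule expectation_step[where f = "\<lambda>_ u j. u\<^sup>2 + g (Suc n) j" and H = "\<lambda>_. ()", OF adapted_const])
  also have "(\<lambda>\<omega>. \<Sum>j\<in>UNIV. T n $ X n \<omega> $ j *\<^sub>R ((U n \<omega> + d n (X n \<omega>) j)\<^sup>2 + g (Suc n) j))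
      = (\<lambda>\<omega>. (U n \<omega>)\<^sup>2 + g n (X n \<omega>) + \<sigma>2)"
  proof
    fix \<omega>
    have "(\<Sum>j\<in>UNIV. T n $ X n \<omega> $ j *\<^sub>R ((U n \<omega> + d n (X n \<omega>) j)\<^sup>2 + g (Suc n) j))
        = (\<Sum>j\<in>UNIV. T n $ X n \<omega> $ j * (U n \<omega>)\<^sup>2)
          + 2 * U n \<omega> * (\<Sum>j\<in>UNIV. T n $ X n \<omega> $ j * d n (X n \<omega>) j)
          + (\<Sum>j\<in>UNIV. T n $ X n \<omega> $ j * ((d n (X n \<omega>) j)\<^sup>2 + g (Suc n) j))"
      by (simp add: power2_sum ring_distribs sum.distrib sum_distrib_left mult_ac)
    also have "\<dots> = (U n \<omega>)\<^sup>2 + g n (X n \<omega>) + \<sigma>2"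
      unfolding d_mean g_step by (simp add: T_sum flip: sum_distrib_right)
    finally show "(\<Sum>j\<in>UNIV. T n $ X n \<omega> $ j *\<^sub>R ((U n \<omega> + d n (X n \<omega>) j)\<^sup>2 + g (Suc n) j))
        = (U n \<omega>)\<^sup>2 + g n (X n \<omega>) + \<sigma>2" .
  qed
  also have "expectation \<dots> = expectation (\<lambda>\<omega>. (U n \<omega>)\<^sup>2 + g n (X n \<omega>)) + \<sigma>2"
    using integrable_past[of n "\<lambda>_. ()" "\<lambda>_ u j. u\<^sup>2 + g n j"]
    by (subst Bochner_Integration.integral_add) (auto simp: prob_space)
  finally show ?case
    using Suc by (simp add: algebra_simps)
qed simp

lemma second_moment: "\<bar>expectation (\<lambda>\<omega>. (U n \<omega>)\<^sup>2) - real n * \<sigma>2\<bar> \<le> C\<^sup>2 + 2 * C"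
proof -
  have "expectation (\<lambda>\<omega>. (U n \<omega>)\<^sup>2 + g n (X n \<omega>))
      = expectation (\<lambda>\<omega>. (U n \<omega>)\<^sup>2) + expectation (\<lambda>\<omega>. g n (X n \<omega>))"
    using integrable_past[of n "\<lambda>_. ()" "\<lambda>_ u j. u\<^sup>2"] integrable_past[of n "\<lambda>_. ()" "\<lambda>_ u j. g n j"]
    by (intro Bochner_Integration.integral_add) auto
  moreover have "norm (expectation (\<lambda>\<omega>. g n (X n \<omega>))) \<le> C"
    using integrable_past[of n "\<lambda>_. ()" "\<lambda>_ u j. g n j"] g_bound
    by (intro norm_expectation_le) auto
  moreover have "norm (expectation (\<lambda>\<omega>. (U 0 \<omega>)\<^sup>2 + g 0 (X 0 \<omega>))) \<le> C\<^sup>2 + C"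
  proof (rule norm_expectation_le)
    show "integrable M (\<lambda>\<omega>. (U 0 \<omega>)\<^sup>2 + g 0 (X 0 \<omega>))"
      using integrable_past[of 0 "\<lambda>_. ()" "\<lambda>_ u j. u\<^sup>2 + g 0 j"] by auto
    show "norm ((U 0 \<omega>)\<^sup>2 + g 0 (X 0 \<omega>)) \<le> C\<^sup>2 + C" for \<omega>
    proof -
      have "\<bar>U 0 \<omega>\<bar>\<^sup>2 \<le> C\<^sup>2"
        using U_0 by (intro power_mono) auto
      then show ?thesis
        using g_bound[of 0 "X 0 \<omega>"] by (simp add: abs_le_iff) (smt (verit) zero_le_power2)
    qed
  qed
  ultimately show ?thesis
    using second_moment_step[of n] by (simp add: abs_le_iff)
qed

subsection \<open>Exponential moments\<close>

text \<open>The three errors of \<open>exp_kernel\<close>: the second-order Taylor remainder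
  (\<open>C ^ 3\<close>), the factor \<open>exp - 1\<close> multiplying the corrector
  (\<open>C\<^sup>2\<close>), and the product of \<sigma>2 and the corrector left over by
  factorising.\<close>

definition rate :: real where
  "rate = exp C * (C ^ 3 + C\<^sup>2) + \<bar>\<sigma>2\<bar> * C"

text \<open>After expanding to second order, the linear term vanishes by \<open>d_mean\<close>, and
  \<open>g_step\<close> turns the quadratic one into \<open>g k i + \<sigma>2\<close>, whose
  dependence on the state is again only the corrector.\<close>

lemma exp_kernel:
  fixes z :: "'b::{real_normed_field, banach}"
  assumes z: "norm z \<le> 1"
  shows "norm ((\<Sum>j\<in>UNIV. T k $ i $ j *\<^sub>R (exp (z * of_real (d k i j)) * (1 + z\<^sup>2 / 2 * of_real (g (Suc k) j))))
      - (1 + z\<^sup>2 / 2 * of_real \<sigma>2) * (1 + z\<^sup>2 / 2 * of_real (g k i))) \<le> rate * norm z ^ 3"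
proof -
  define r where "r j = exp (z * of_real (d k i j)) * (1 + z\<^sup>2 / 2 * of_real (g (Suc k) j))
      - (1 + z * of_real (d k i j) + z\<^sup>2 / 2 * of_real ((d k i j)\<^sup>2 + g (Suc k) j))" for j
  have r: "norm (r j) \<le> exp C * (C ^ 3 + C\<^sup>2) * norm z ^ 3" for j
  proof -
    let ?x = "z * of_real (d k i j)"
    have nx: "norm ?x \<le> C * norm z"
      using mult_right_mono[OF d_bound[of k i j], of "norm z"] by (simp add: norm_mult mult.commute)
    have Cz: "C * norm z \<le> C"
      using z C_nonneg by (simp add: mult_left_le)
    have "norm (exp ?x - (1 + ?x + ?x\<^sup>2 / 2)) \<le> exp (C * norm z) * (C * norm z) ^ 3 / 2"
      by (rule exp_Taylor_2) (rule nx)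
    also have "\<dots> \<le> exp C * (C * norm z) ^ 3 / 2"
      using Cz C_nonneg by (intro divide_right_mono mult_right_mono) auto
    finally have t2: "norm (exp ?x - (1 + ?x + ?x\<^sup>2 / 2)) \<le> exp C * C ^ 3 * norm z ^ 3 / 2"
      by (simp add: power_mult_distrib mult.assoc)
    have "norm (exp ?x - 1) \<le> exp (C * norm z) * (C * norm z)"
      by (rule exp_Taylor_0) (rule nx)
    also have "\<dots> \<le> exp C * (C * norm z)"
      using Cz C_nonneg by (intro mult_right_mono) auto
    finally have "norm (exp ?x - 1) * (norm z ^ 2 / 2 * \<bar>g (Suc k) j\<bar>) \<le> (exp C * (C * norm z)) * (norm z ^ 2 / 2 * C)"
      using g_bound C_nonneg by (intro mult_mono) auto
    then have t0: "norm ((exp ?x - 1) * (z\<^sup>2 / 2 * of_real (g (Suc k) j))) \<le> exp C * C\<^sup>2 * norm z ^ 3 / 2"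
      by (simp add: norm_mult norm_divide norm_power power2_eq_square power3_eq_cube mult_ac)
    have "r j = (exp ?x - (1 + ?x + ?x\<^sup>2 / 2)) + (exp ?x - 1) * (z\<^sup>2 / 2 * of_real (g (Suc k) j))"
      by (simp add: r_def power_mult_distrib field_simps)
    then have "norm (r j) \<le> exp C * C ^ 3 * norm z ^ 3 / 2 + exp C * C\<^sup>2 * norm z ^ 3 / 2"
      using norm_triangle_mono[OF t2 t0] by simp
    also have "\<dots> = (exp C * (C ^ 3 + C\<^sup>2) * norm z ^ 3) / 2"
      by (simp add: algebra_simps)
    also have "\<dots> \<le> exp C * (C ^ 3 + C\<^sup>2) * norm z ^ 3"
      using C_nonneg by simp
    finally show ?thesis .
  qed
  have main: "(\<Sum>j\<in>UNIV. T k $ i $ j *\<^sub>R (1 + z * of_real (d k i j) + z\<^sup>2 / 2 * of_real ((d k i j)\<^sup>2 + g (Suc k) j)))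
      = 1 + z\<^sup>2 / 2 * of_real (g k i + \<sigma>2)"
  proof -
    have "(\<Sum>j\<in>UNIV. T k $ i $ j *\<^sub>R (1 + z * of_real (d k i j) + z\<^sup>2 / 2 * of_real ((d k i j)\<^sup>2 + g (Suc k) j)))
        = of_real (\<Sum>j\<in>UNIV. T k $ i $ j) + z * of_real (\<Sum>j\<in>UNIV. T k $ i $ j * d k i j)
          + z\<^sup>2 / 2 * of_real (\<Sum>j\<in>UNIV. T k $ i $ j * ((d k i j)\<^sup>2 + g (Suc k) j))"
      unfolding of_real_sum sum_distrib_left sum.distrib[symmetric]
      by (intro sum.cong refl) (simp add: scaleR_conv_of_real algebra_simps)
    then show ?thesis
      by (simp add: T_sum d_mean g_step)
  qed
  have "(\<Sum>j\<in>UNIV. T k $ i $ j *\<^sub>R (exp (z * of_real (d k i j)) * (1 + z\<^sup>2 / 2 * of_real (g (Suc k) j))))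
      = (\<Sum>j\<in>UNIV. T k $ i $ j *\<^sub>R r j) + (1 + z\<^sup>2 / 2 * of_real (g k i + \<sigma>2))"
    unfolding main[symmetric] sum.distrib[symmetric]
    by (intro sum.cong refl) (simp add: r_def flip: scaleR_add_right)
  \<comment> \<open>Passing from the sum to a product costs only a term of order
    \<open>z ^ 4\<close>, and only the product form can be iterated.\<close>
  moreover have "1 + a * of_real (g k i + \<sigma>2)
      = (1 + a * of_real \<sigma>2) * (1 + a * of_real (g k i)) - (a * of_real \<sigma>2) * (a * of_real (g k i))" for a :: 'b
    by (simp add: algebra_simps)
  moreover have "x + (p - q) - p = x - q" for x p q :: 'b
    by simp
  ultimately have eq: "(\<Sum>j\<in>UNIV. T k $ i $ j *\<^sub>R (exp (z * of_real (d k i j)) * (1 + z\<^sup>2 / 2 * of_real (g (Suc k) j))))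
      - (1 + z\<^sup>2 / 2 * of_real \<sigma>2) * (1 + z\<^sup>2 / 2 * of_real (g k i))
      = (\<Sum>j\<in>UNIV. T k $ i $ j *\<^sub>R r j) - (z\<^sup>2 / 2 * of_real \<sigma>2) * (z\<^sup>2 / 2 * of_real (g k i))"
    by (simp only:)
  have a: "norm (\<Sum>j\<in>UNIV. T k $ i $ j *\<^sub>R r j) \<le> exp C * (C ^ 3 + C\<^sup>2) * norm z ^ 3"
    by (rule norm_kernel_le) (rule r)
  have b: "norm ((z\<^sup>2 / 2 * of_real \<sigma>2) * (z\<^sup>2 / 2 * of_real (g k i))) \<le> \<bar>\<sigma>2\<bar> * C * norm z ^ 3"
  proof -
    have "norm ((z\<^sup>2 / 2 * of_real \<sigma>2) * (z\<^sup>2 / 2 * of_real (g k i)))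
        = \<bar>\<sigma>2\<bar> * \<bar>g k i\<bar> * (norm z ^ 4 / 4)"
      by (simp add: norm_mult norm_divide norm_power power2_eq_square power4_eq_xxxx mult_ac)
    also have "\<dots> \<le> \<bar>\<sigma>2\<bar> * C * norm z ^ 3"
    proof (intro mult_mono)
      show "norm z ^ 4 / 4 \<le> norm z ^ 3"
      proof -
        have "norm z ^ 4 \<le> norm z ^ 3"
          by (rule power_decreasing) (use z in auto)
        moreover have "0 \<le> norm z ^ 4"
          by simp
        ultimately show ?thesis
          by linarith
      qed
    qed (use g_bound C_nonneg in auto)
    finally show ?thesis .
  qed
  show ?thesis
    unfolding eq rate_def distrib_right[of "exp C * _"]
    by (rule order_trans[OF norm_triangle_ineq4 add_mono[OF a b]])
qed

end

context corrected_walk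
begin

subsection \<open>Characteristic functions\<close>

lemma norm_exp_ii_mult: "norm (exp (\<i> * of_real \<theta> * of_real x) :: complex) = 1"
  using norm_exp_i_times[of "\<theta> * x"] by (simp add: mult.assoc)

text \<open>This is \<open>exp_kernel\<close> at imaginary argument. The prefactor coming from
  \<open>U k\<close> has modulus 1, so the error does not depend on the size of
  \<open>U k\<close>.\<close>

lemma char_recursion:
  assumes \<theta>: "\<bar>\<theta>\<bar> \<le> 1"
  defines "y \<equiv> \<lambda>k. expectation (\<lambda>\<omega>. exp (\<i> * of_real \<theta> * of_real (U k \<omega>))
                         * (1 - of_real (\<theta>\<^sup>2 / 2 * g k (X k \<omega>))))"
  shows "norm (y (Suc k) - of_real (1 - \<theta>\<^sup>2 * \<sigma>2 / 2) * y k) \<le> rate * \<bar>\<theta>\<bar> ^ 3"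
proof -
  let ?z = "\<i> * of_real \<theta> :: complex"
  let ?F = "\<lambda>u i. \<Sum>j\<in>UNIV. T k $ i $ j *\<^sub>R
      (exp (?z * of_real (u + d k i j)) * (1 - of_real (\<theta>\<^sup>2 / 2 * g (Suc k) j)))"
  let ?G = "\<lambda>u i. exp (?z * of_real u) * (1 - of_real (\<theta>\<^sup>2 / 2 * g k i)) :: complex"
  have z2: "?z\<^sup>2 = - of_real (\<theta>\<^sup>2)"
    by (simp add: power_mult_distrib)
  have y_Suc: "y (Suc k) = expectation (\<lambda>\<omega>. ?F (U k \<omega>) (X k \<omega>))"
    unfolding y_def
    by (rule expectation_step[where H = "\<lambda>_. ()" and
          f = "\<lambda>_ u j. exp (?z * of_real u) * (1 - of_real (\<theta>\<^sup>2 / 2 * g (Suc k) j))"]) (rule adapted_const)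
  have F: "?F u i = exp (?z * of_real u) *
      (\<Sum>j\<in>UNIV. T k $ i $ j *\<^sub>R (exp (?z * of_real (d k i j)) * (1 + ?z\<^sup>2 / 2 * of_real (g (Suc k) j))))" for u i
    unfolding z2 sum_distrib_left
    by (intro sum.cong refl) (simp add: exp_add ring_distribs)
  have G: "of_real (1 - \<theta>\<^sup>2 * \<sigma>2 / 2) * ?G u i = exp (?z * of_real u) *
      ((1 + ?z\<^sup>2 / 2 * of_real \<sigma>2) * (1 + ?z\<^sup>2 / 2 * of_real (g k i)))" for u i
    unfolding z2 by (simp add: mult_ac)
  have int: "integrable M (\<lambda>\<omega>. ?F (U k \<omega>) (X k \<omega>))" "integrable M (\<lambda>\<omega>. ?G (U k \<omega>) (X k \<omega>))"
    by (rule integrable_past[where H = "\<lambda>_. ()" and f = "\<lambda>_ u i. ?F u i"], rule adapted_const)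
       (rule integrable_past[where H = "\<lambda>_. ()" and f = "\<lambda>_ u i. ?G u i"], rule adapted_const)
  have "y (Suc k) - of_real (1 - \<theta>\<^sup>2 * \<sigma>2 / 2) * y k
      = expectation (\<lambda>\<omega>. ?F (U k \<omega>) (X k \<omega>) - of_real (1 - \<theta>\<^sup>2 * \<sigma>2 / 2) * ?G (U k \<omega>) (X k \<omega>))"
    unfolding y_Suc unfolding y_def using int
    by (subst Bochner_Integration.integral_diff) auto
  also have "norm \<dots> \<le> rate * \<bar>\<theta>\<bar> ^ 3"
  proof (rule norm_expectation_le)
    show "integrable M (\<lambda>\<omega>. ?F (U k \<omega>) (X k \<omega>) - of_real (1 - \<theta>\<^sup>2 * \<sigma>2 / 2) * ?G (U k \<omega>) (X k \<omega>))"
      using int by auto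
    fix \<omega>
    let ?u = "U k \<omega>" and ?i = "X k \<omega>"
    have "?F ?u ?i - of_real (1 - \<theta>\<^sup>2 * \<sigma>2 / 2) * ?G ?u ?i = exp (?z * of_real ?u) *
       ((\<Sum>j\<in>UNIV. T k $ ?i $ j *\<^sub>R (exp (?z * of_real (d k ?i j)) * (1 + ?z\<^sup>2 / 2 * of_real (g (Suc k) j))))
        - (1 + ?z\<^sup>2 / 2 * of_real \<sigma>2) * (1 + ?z\<^sup>2 / 2 * of_real (g k ?i)))"
      unfolding F G by (simp only: right_diff_distrib)
    moreover have "norm ((\<Sum>j\<in>UNIV. T k $ ?i $ j *\<^sub>R (exp (?z * of_real (d k ?i j)) * (1 + ?z\<^sup>2 / 2 * of_real (g (Suc k) j))))
        - (1 + ?z\<^sup>2 / 2 * of_real \<sigma>2) * (1 + ?z\<^sup>2 / 2 * of_real (g k ?i))) \<le> rate * norm ?z ^ 3"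
      by (rule exp_kernel) (use \<theta> in \<open>simp add: norm_mult\<close>)
    ultimately show "norm (?F ?u ?i - of_real (1 - \<theta>\<^sup>2 * \<sigma>2 / 2) * ?G ?u ?i) \<le> rate * \<bar>\<theta>\<bar> ^ 3"
      by (simp only: norm_mult norm_exp_ii_mult) (simp add: norm_mult)
  qed
  finally show ?thesis .
qed

text \<open>The condition \<open>\<theta>\<^sup>2 * \<sigma>2 \<le> 4\<close> keeps the factor of
  the recursion in [-1, 1], so the errors of \<open>n\<close> steps merely add up. Replacing
  \<open>y 0\<close> by 1, and \<open>y n\<close> by the characteristic function of
  \<open>U n + b (X n)\<close>, costs two bounded perturbations each. The function \<open>b\<close>
  stands for the bounded difference between the walk and the centred payoff.\<close>

lemma char_bound:
  assumes \<theta>: "\<bar>\<theta>\<bar> \<le> 1" and \<sigma>: "0 \<le> \<sigma>2" "\<theta>\<^sup>2 * \<sigma>2 \<le> 4" and b: "\<And>i. \<bar>b i\<bar> \<le> C"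
  shows "norm (expectation (\<lambda>\<omega>. exp (\<i> * of_real \<theta> * of_real (U n \<omega> + b (X n \<omega>))))
           - of_real ((1 - \<theta>\<^sup>2 * \<sigma>2 / 2) ^ n)) \<le> real n * (rate * \<bar>\<theta>\<bar> ^ 3) + 4 * C * \<bar>\<theta>\<bar>"
proof -
  define y where "y k = expectation (\<lambda>\<omega>. exp (\<i> * of_real \<theta> * of_real (U k \<omega>))
                         * (1 - of_real (\<theta>\<^sup>2 / 2 * g k (X k \<omega>))))" for k
  let ?q = "1 - \<theta>\<^sup>2 * \<sigma>2 / 2"
  have q: "\<bar>?q\<bar> \<le> 1"
    using \<sigma> by (simp add: abs_le_iff)
  have y: "norm (y k - of_real (?q ^ k) * y 0) \<le> real k * (rate * \<bar>\<theta>\<bar> ^ 3)" for k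
  proof (induction k)
    case (Suc k)
    have "y (Suc k) - of_real (?q ^ Suc k) * y 0
        = (y (Suc k) - of_real ?q * y k) + of_real ?q * (y k - of_real (?q ^ k) * y 0)"
      by (simp add: algebra_simps)
    also have "norm \<dots> \<le> rate * \<bar>\<theta>\<bar> ^ 3 + real k * (rate * \<bar>\<theta>\<bar> ^ 3)"
    proof (rule norm_triangle_mono)
      show "norm (y (Suc k) - of_real ?q * y k) \<le> rate * \<bar>\<theta>\<bar> ^ 3"
        unfolding y_def by (rule char_recursion[OF \<theta>])
      have "norm (of_real ?q * (y k - of_real (?q ^ k) * y 0)) \<le> 1 * (real k * (rate * \<bar>\<theta>\<bar> ^ 3))"
        unfolding norm_mult norm_of_real using q Suc by (intro mult_mono) auto
      then show "norm (of_real ?q * (y k - of_real (?q ^ k) * y 0)) \<le> real k * (rate * \<bar>\<theta>\<bar> ^ 3)"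
        by simp
    qed
    finally show ?case
      by (simp add: algebra_simps)
  qed simp
  have phase: "norm (exp (\<i> * of_real \<theta> * of_real x) - 1 :: complex) \<le> C * \<bar>\<theta>\<bar>" if "\<bar>x\<bar> \<le> C" for x
  proof -
    have "norm (exp (\<i> * of_real \<theta> * of_real x) - 1 :: complex) \<le> \<bar>\<theta> * x\<bar>"
      using iexp_approx1[of "\<theta> * x" 0] by (simp add: mult.assoc)
    also have "\<dots> \<le> C * \<bar>\<theta>\<bar>"
      using mult_right_mono[OF that, of "\<bar>\<theta>\<bar>"] by (simp add: abs_mult mult.commute)
    finally show ?thesis .
  qed
  have quad: "\<bar>\<theta>\<^sup>2 / 2 * g k i\<bar> \<le> C * \<bar>\<theta>\<bar>" for k i
  proof -
    have "\<theta>\<^sup>2 / 2 \<le> \<bar>\<theta>\<bar>"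
      using \<theta> mult_left_le_one_le[of "\<bar>\<theta>\<bar>" "\<bar>\<theta>\<bar>"] by (simp add: power2_eq_square flip: abs_mult)
    then have "\<bar>\<theta>\<^sup>2 / 2\<bar> * \<bar>g k i\<bar> \<le> \<bar>\<theta>\<bar> * C"
      using g_bound by (intro mult_mono) auto
    then show ?thesis
      by (simp add: abs_mult mult.commute)
  qed
  have y0: "norm (y 0 - 1) \<le> 2 * C * \<bar>\<theta>\<bar>"
  proof -
    let ?f = "\<lambda>\<omega>. exp (\<i> * of_real \<theta> * of_real (U 0 \<omega>)) * (1 - of_real (\<theta>\<^sup>2 / 2 * g 0 (X 0 \<omega>))) :: complex"
    have int: "integrable M ?f"
      by (rule integrable_past[where H = "\<lambda>_. ()" and f = "\<lambda>_ u i.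
            exp (\<i> * of_real \<theta> * of_real u) * (1 - of_real (\<theta>\<^sup>2 / 2 * g 0 i)) :: complex"]) (rule adapted_const)
    then have "y 0 - 1 = expectation (\<lambda>\<omega>. ?f \<omega> - 1)"
      by (simp add: y_def prob_space)
    also have "norm \<dots> \<le> 2 * C * \<bar>\<theta>\<bar>"
    proof (rule norm_expectation_le)
      show "integrable M (\<lambda>\<omega>. ?f \<omega> - 1)"
        using int by simp
      fix \<omega>
      have "?f \<omega> - 1 = (exp (\<i> * of_real \<theta> * of_real (U 0 \<omega>)) - 1)
          - exp (\<i> * of_real \<theta> * of_real (U 0 \<omega>)) * of_real (\<theta>\<^sup>2 / 2 * g 0 (X 0 \<omega>))"
        by (simp add: algebra_simps)
      also have "norm \<dots> \<le> C * \<bar>\<theta>\<bar> + C * \<bar>\<theta>\<bar>"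
      proof (rule order_trans[OF norm_triangle_ineq4 add_mono[OF phase[OF U_0]]])
        show "norm (exp (\<i> * of_real \<theta> * of_real (U 0 \<omega>)) * of_real (\<theta>\<^sup>2 / 2 * g 0 (X 0 \<omega>)) :: complex)
            \<le> C * \<bar>\<theta>\<bar>"
          by (simp only: norm_mult norm_exp_ii_mult norm_of_real mult_1_left quad)
      qed
      finally show "norm (?f \<omega> - 1) \<le> 2 * C * \<bar>\<theta>\<bar>"
        by simp
    qed
    finally show ?thesis .
  qed
  let ?e = "\<lambda>\<omega>. exp (\<i> * of_real \<theta> * of_real (U n \<omega> + b (X n \<omega>))) :: complex"
  have last: "norm (expectation ?e - y n) \<le> 2 * C * \<bar>\<theta>\<bar>"
  proof -
    let ?f = "\<lambda>\<omega>. exp (\<i> * of_real \<theta> * of_real (U n \<omega>)) * (1 - of_real (\<theta>\<^sup>2 / 2 * g n (X n \<omega>))) :: complex"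
    have int: "integrable M ?f" "integrable M ?e"
      by (rule integrable_past[where H = "\<lambda>_. ()" and f = "\<lambda>_ u i.
            exp (\<i> * of_real \<theta> * of_real u) * (1 - of_real (\<theta>\<^sup>2 / 2 * g n i)) :: complex"], rule adapted_const)
         (rule integrable_past[where H = "\<lambda>_. ()" and f = "\<lambda>_ u i.
            exp (\<i> * of_real \<theta> * of_real (u + b i)) :: complex"], rule adapted_const)
    then have "expectation ?e - y n = expectation (\<lambda>\<omega>. ?e \<omega> - ?f \<omega>)"
      by (simp add: y_def)
    also have "norm \<dots> \<le> 2 * C * \<bar>\<theta>\<bar>"
    proof (rule norm_expectation_le)
      show "integrable M (\<lambda>\<omega>. ?e \<omega> - ?f \<omega>)"
        using int by simp
      fix \<omega>
      have "?e \<omega> - ?f \<omega> = exp (\<i> * of_real \<theta> * of_real (U n \<omega>)) *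
          ((exp (\<i> * of_real \<theta> * of_real (b (X n \<omega>))) - 1) + of_real (\<theta>\<^sup>2 / 2 * g n (X n \<omega>)))"
        by (simp add: exp_add algebra_simps)
      also have "norm \<dots> \<le> C * \<bar>\<theta>\<bar> + C * \<bar>\<theta>\<bar>"
        unfolding norm_mult norm_exp_ii_mult mult_1_left
        by (intro norm_triangle_mono phase b) (simp only: norm_of_real quad)
      finally show "norm (?e \<omega> - ?f \<omega>) \<le> 2 * C * \<bar>\<theta>\<bar>"
        by simp
    qed
    finally show ?thesis .
  qed
  have first: "norm (of_real (?q ^ n) * (y 0 - 1)) \<le> 1 * (2 * C * \<bar>\<theta>\<bar>)"
    unfolding norm_mult norm_of_real using q y0 by (intro mult_mono) (auto simp: power_abs power_le_one)
  have split: "expectation ?e - of_real (?q ^ n)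
      = (expectation ?e - y n) + (y n - of_real (?q ^ n) * y 0) + of_real (?q ^ n) * (y 0 - 1)"
    by (simp add: algebra_simps)
  have "norm (expectation ?e - of_real (?q ^ n))
      \<le> 2 * C * \<bar>\<theta>\<bar> + real n * (rate * \<bar>\<theta>\<bar> ^ 3) + 1 * (2 * C * \<bar>\<theta>\<bar>)"
    unfolding split by (intro norm_triangle_mono last y first)
  then show ?thesis
    by linarith
qed

text \<open>The scaling makes \<open>real n * (\<theta> n)\<^sup>2\<close> constant for positive
  \<open>n\<close>. Hence both errors of \<open>char_bound\<close> are multiples of
  \<open>\<bar>\<theta> n\<bar>\<close>, while the main term is the \<open>n\<close>-th power that
  defines the exponential.\<close>

lemma char_tendsto:
  assumes \<sigma>: "0 < \<sigma>2" and b: "\<And>n i. \<bar>b n i\<bar> \<le> C"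
  shows "(\<lambda>n. expectation (\<lambda>\<omega>. exp (\<i> * of_real (t / sqrt (real n * \<sigma>2)) * of_real (U n \<omega> + b n (X n \<omega>)))))
     \<longlonglongrightarrow> complex_of_real (exp (- (t\<^sup>2) / 2))"
proof -
  define \<theta> where "\<theta> n = t / sqrt (real n * \<sigma>2)" for n
  have \<theta>_0: "\<theta> \<longlonglongrightarrow> 0"
    unfolding \<theta>_def using \<sigma> by real_asymp
  have sq: "(\<theta> n)\<^sup>2 * \<sigma>2 = t\<^sup>2 / real n" if "n > 0" for n
    using \<sigma> that by (simp add: \<theta>_def power_divide)
  \<comment> \<open>The bound 1 is required by the expansion; multiplied with
    \<open>1 / \<sigma>2\<close> it gives \<open>(\<theta> n)\<^sup>2 * \<sigma>2 \<le> 1\<close>,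
    well within the 4 allowed by \<open>char_bound\<close>.\<close>
  have small: "\<forall>\<^sub>F n in sequentially. \<bar>\<theta> n\<bar> \<le> min 1 (1 / \<sigma>2)"
    using order_tendstoD(2)[OF tendsto_rabs_zero[OF \<theta>_0], of "min 1 (1 / \<sigma>2)"] \<sigma>
    by (auto elim: eventually_mono)
  have bound: "\<forall>\<^sub>F n in sequentially.
      norm (expectation (\<lambda>\<omega>. exp (\<i> * of_real (\<theta> n) * of_real (U n \<omega> + b n (X n \<omega>))))
        - of_real ((1 + (- (t\<^sup>2) / 2) / real n) ^ n)) \<le> (rate * t\<^sup>2 / \<sigma>2 + 4 * C) * \<bar>\<theta> n\<bar>"
    using small eventually_gt_at_top[of 0]
  proof eventually_elim
    case (elim n)
    then have "\<bar>\<theta> n\<bar> * \<bar>\<theta> n\<bar> \<le> 1 * (1 / \<sigma>2)"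
      by (intro mult_mono) auto
    then have "(\<theta> n)\<^sup>2 * \<sigma>2 \<le> 4"
      using \<sigma> by (simp add: power2_eq_square field_simps flip: abs_mult)
    with elim have "norm (expectation (\<lambda>\<omega>. exp (\<i> * of_real (\<theta> n) * of_real (U n \<omega> + b n (X n \<omega>))))
        - of_real ((1 - (\<theta> n)\<^sup>2 * \<sigma>2 / 2) ^ n)) \<le> real n * (rate * \<bar>\<theta> n\<bar> ^ 3) + 4 * C * \<bar>\<theta> n\<bar>"
      using \<sigma> b by (intro char_bound) auto
    also have "real n * (rate * \<bar>\<theta> n\<bar> ^ 3) = rate * t\<^sup>2 / \<sigma>2 * \<bar>\<theta> n\<bar>"
    proof -
      have "real n * (\<theta> n)\<^sup>2 = t\<^sup>2 / \<sigma>2"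
        using sq[of n] elim \<sigma> by (simp add: field_simps)
      moreover have "real n * (rate * \<bar>\<theta> n\<bar> ^ 3) = rate * (real n * (\<theta> n)\<^sup>2) * \<bar>\<theta> n\<bar>"
        by (simp add: power3_eq_cube power2_eq_square)
      ultimately show ?thesis
        by simp
    qed
    also have "1 - (\<theta> n)\<^sup>2 * \<sigma>2 / 2 = 1 + (- (t\<^sup>2) / 2) / real n"
      using sq[of n] elim by simp
    finally show ?case
      by (simp only: distrib_right)
  qed
  have "(\<lambda>n. (rate * t\<^sup>2 / \<sigma>2 + 4 * C) * \<bar>\<theta> n\<bar>) \<longlonglongrightarrow> 0"
    using tendsto_mult_left[OF tendsto_rabs_zero[OF \<theta>_0]] by simp
  then have null: "(\<lambda>n. expectation (\<lambda>\<omega>. exp (\<i> * of_real (\<theta> n) * of_real (U n \<omega> + b n (X n \<omega>))))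
        - of_real ((1 + (- (t\<^sup>2) / 2) / real n) ^ n)) \<longlonglongrightarrow> 0"
    by (rule Lim_null_comparison[OF bound])
  have lim: "(\<lambda>n. complex_of_real ((1 + (- (t\<^sup>2) / 2) / real n) ^ n)) \<longlonglongrightarrow> of_real (exp (- (t\<^sup>2) / 2))"
    by (intro tendsto_of_real tendsto_exp_limit_sequentially)
  show ?thesis
    by (rule Lim_transform[OF lim null, unfolded \<theta>_def])
qed

lemma central_limit:
  assumes \<sigma>: "0 < \<sigma>2" and b: "\<And>n i. \<bar>b n i\<bar> \<le> C"
  shows "weak_conv_m (\<lambda>n. distr M borel (\<lambda>\<omega>. (U n \<omega> + b n (X n \<omega>)) / sqrt (real n * \<sigma>2)))
           std_normal_distribution"
proof (rule levy_continuity)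
  have meas [measurable]: "(\<lambda>\<omega>. (U n \<omega> + b n (X n \<omega>)) / sqrt (real n * \<sigma>2)) \<in> borel_measurable M" for n
    by (rule borel_measurable_integrable, rule integrable_past[where H = "\<lambda>_. ()" and
          f = "\<lambda>_ u i. (u + b n i) / sqrt (real n * \<sigma>2)"]) (rule adapted_const)
  show "real_distribution (distr M borel (\<lambda>\<omega>. (U n \<omega> + b n (X n \<omega>)) / sqrt (real n * \<sigma>2)))" for n
    by (rule real_distribution_distr) (rule meas)
  show "real_distribution std_normal_distribution"
    by (simp add: real_dist_normal_dist)
  have "char (distr M borel (\<lambda>\<omega>. (U n \<omega> + b n (X n \<omega>)) / sqrt (real n * \<sigma>2))) t
      = expectation (\<lambda>\<omega>. exp (\<i> * of_real (t / sqrt (real n * \<sigma>2)) * of_real (U n \<omega> + b n (X n \<omega>))))" for n t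
    unfolding char_def by (subst integral_distr[OF meas]) (simp_all add: mult_ac)
  then show "(\<lambda>n. char (distr M borel (\<lambda>\<omega>. (U n \<omega> + b n (X n \<omega>)) / sqrt (real n * \<sigma>2))) t)
      \<longlonglongrightarrow> char std_normal_distribution t" for t
    unfolding char_std_normal_distribution using char_tendsto[OF \<sigma> b] by simp
qed

end

subsection \<open>Strong law of large numbers\<close>

lemma filterlim_floor_sqrt: "filterlim floor_sqrt at_top sequentially"
  unfolding filterlim_at_top
proof
  fix Z
  show "\<forall>\<^sub>F n in sequentially. Z \<le> floor_sqrt n"
    using eventually_ge_at_top[of "Z\<^sup>2"]
    by eventually_elim (metis floor_sqrt_inverse_power2 mono_floor_sqrt')
qed

text \<open>From the last square \<open>k\<^sup>2\<close> up to \<open>n\<close> there are at most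
  \<open>2 * k\<close> steps, so \<open>u\<close> changes by at most \<open>2 * C * k\<close>, which
  is negligible against \<open>k\<^sup>2\<close>.\<close>

lemma LIMSEQ_div_from_squares:
  fixes u :: "nat \<Rightarrow> real"
  assumes inc: "\<And>n. \<bar>u (Suc n) - u n\<bar> \<le> C"
    and lim: "(\<lambda>k. u ((Suc k)\<^sup>2) / real ((Suc k)\<^sup>2)) \<longlonglongrightarrow> 0"
  shows "(\<lambda>n. u n / real n) \<longlonglongrightarrow> 0"
proof -
  have C: "0 \<le> C"
    using inc[of 0] by linarith
  have incs: "\<bar>u (n + m) - u n\<bar> \<le> C * real m" for n m
  proof (induction m)
    case (Suc m)
    then show ?case
      using inc[of "n + m"] by (simp add: algebra_simps)
  qed simp
  have v: "(\<lambda>k. \<bar>u (k\<^sup>2) / real (k\<^sup>2)\<bar>) \<longlonglongrightarrow> 0"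
    using lim filterlim_sequentially_Suc[of "\<lambda>k. u (k\<^sup>2) / real (k\<^sup>2)"]
    by (intro tendsto_rabs_zero) simp
  have "(\<lambda>k. 2 * C / real k) \<longlonglongrightarrow> 0"
    by real_asymp
  with v have "(\<lambda>k. \<bar>u (k\<^sup>2) / real (k\<^sup>2)\<bar> + 2 * C / real k) \<longlonglongrightarrow> 0 + 0"
    by (intro tendsto_add)
  then have "((\<lambda>n. \<bar>u ((floor_sqrt n)\<^sup>2) / real ((floor_sqrt n)\<^sup>2)\<bar> + 2 * C / real (floor_sqrt n)) \<longlongrightarrow> 0) sequentially"
    using filterlim_compose[OF _ filterlim_floor_sqrt] by fastforce
  moreover have "\<forall>\<^sub>F n in sequentially.
      norm (u n / real n) \<le> \<bar>u ((floor_sqrt n)\<^sup>2) / real ((floor_sqrt n)\<^sup>2)\<bar> + 2 * C / real (floor_sqrt n)"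
    using eventually_gt_at_top[of 0]
  proof eventually_elim
    case (elim n)
    define k where "k = floor_sqrt n"
    have k: "k > 0" "k\<^sup>2 \<le> n" "n \<le> k\<^sup>2 + 2 * k"
      using elim Suc_floor_sqrt_power2_gt[of n] floor_sqrt_power2_le[of n]
      unfolding k_def by (simp_all add: power2_eq_square del: floor_sqrt_power2_le)
    have "\<bar>u n - u (k\<^sup>2)\<bar> \<le> C * real (n - k\<^sup>2)"
      using incs[of "k\<^sup>2" "n - k\<^sup>2"] k by simp
    also have "\<dots> \<le> C * real (2 * k)"
      using C k by (intro mult_left_mono of_nat_mono) auto
    finally have "\<bar>u n\<bar> \<le> \<bar>u (k\<^sup>2)\<bar> + 2 * C * real k"
      by simp
    then have "\<bar>u n\<bar> / real n \<le> (\<bar>u (k\<^sup>2)\<bar> + 2 * C * real k) / real (k\<^sup>2)"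
      using C k by (intro frac_le) (auto simp flip: of_nat_power)
    also have "\<dots> = \<bar>u (k\<^sup>2) / real (k\<^sup>2)\<bar> + 2 * C / real k"
      using k by (simp add: add_divide_distrib power2_eq_square)
    finally show ?case
      by (simp add: k_def)
  qed
  ultimately show ?thesis
    by (rule Lim_null_comparison[rotated])
qed

context corrected_walk
begin

lemma U_integrable: "integrable M (U n)"
  using integrable_past[of n "\<lambda>_. ()" "\<lambda>_ u _. u"] by auto

lemma U_measurable [measurable]: "U n \<in> borel_measurable M"
  by (rule borel_measurable_integrable[OF U_integrable])

lemma U_square_integrable: "integrable M (\<lambda>\<omega>. (U n \<omega>)\<^sup>2)"
  using integrable_past[of n "\<lambda>_. ()" "\<lambda>_ u _. u\<^sup>2"] by auto

text \<open>The available bound for the second moment of \<open>U n / n\<close> is of order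
  \<open>1 / n\<close>, which is not summable; along the squares it is of order
  \<open>1 / k\<^sup>2\<close>. The expected sum of the \<open>f k\<close> is then finite, so almost
  surely \<open>f k\<close> tends to 0, and bounded increments fill the gaps.\<close>

lemma strong_law: "AE \<omega> in M. (\<lambda>n. U n \<omega> / real n) \<longlonglongrightarrow> 0"
proof -
  define f where "f k \<omega> = (U ((Suc k)\<^sup>2) \<omega> / real ((Suc k)\<^sup>2))\<^sup>2" for k \<omega>
  define K where "K = \<bar>\<sigma>2\<bar> + C\<^sup>2 + 2 * C"
  have K: "0 \<le> K"
    using C_nonneg by (simp add: K_def)
  have f_int: "integrable M (f k)" for k
    unfolding f_def power_divide by (intro integrable_divide U_square_integrable)
  have f_nonneg: "0 \<le> f k \<omega>" for k \<omega>
    by (simp add: f_def)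
  have E: "expectation (f k) \<le> 2 * K / (real (Suc k))\<^sup>2" for k
  proof -
    let ?n = "(real (Suc k))\<^sup>2"
    have n: "1 \<le> ?n"
      by (rule one_le_power) simp
    have "expectation (f k) = expectation (\<lambda>\<omega>. (U ((Suc k)\<^sup>2) \<omega>)\<^sup>2) / ?n\<^sup>2"
      unfolding f_def power_divide by (simp only: integral_divide_zero of_nat_power)
    also have "\<dots> \<le> (2 * K * ?n) / ?n\<^sup>2"
    proof (rule divide_right_mono)
      have "expectation (\<lambda>\<omega>. (U ((Suc k)\<^sup>2) \<omega>)\<^sup>2) \<le> ?n * \<sigma>2 + (C\<^sup>2 + 2 * C)"
        using second_moment[of "(Suc k)\<^sup>2"] by (simp only: of_nat_power abs_le_iff) linarith
      also have "\<dots> \<le> ?n * K + ?n * K"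
      proof (rule add_mono)
        show "?n * \<sigma>2 \<le> ?n * K"
          using C_nonneg by (intro mult_left_mono) (simp_all add: K_def add_increasing2)
        have "C\<^sup>2 + 2 * C \<le> K"
          by (simp add: K_def)
        also have "K \<le> ?n * K"
          using mult_right_mono[OF n K] by simp
        finally show "C\<^sup>2 + 2 * C \<le> ?n * K" .
      qed
      finally show "expectation (\<lambda>\<omega>. (U ((Suc k)\<^sup>2) \<omega>)\<^sup>2) \<le> 2 * K * ?n"
        by simp
    qed simp
    also have "\<dots> = 2 * K / ?n"
      by (simp add: power2_eq_square)
    finally show ?thesis .
  qed
  have sum: "summable (\<lambda>k. 2 * K / (real (Suc k))\<^sup>2)"
  proof -
    have "summable (\<lambda>k. inverse ((real (Suc k))\<^sup>2))"
      using inverse_power_summable[of 2, where 'a = real] by (subst summable_Suc_iff) simp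
    then show ?thesis
      unfolding divide_inverse by (rule summable_mult)
  qed
  have "(\<integral>\<^sup>+\<omega>. (\<Sum>k. ennreal (f k \<omega>)) \<partial>M) = (\<Sum>k. \<integral>\<^sup>+\<omega>. ennreal (f k \<omega>) \<partial>M)"
    using f_int by (intro nn_integral_suminf) auto
  also have "\<dots> = (\<Sum>k. ennreal (expectation (f k)))"
    using f_int by (intro suminf_cong nn_integral_eq_integral) (auto simp: f_nonneg)
  also have "\<dots> \<le> (\<Sum>k. ennreal (2 * K / (real (Suc k))\<^sup>2))"
    using E by (intro suminf_le ennreal_leI) auto
  also have "\<dots> < \<infinity>"
  proof -
    have "(\<Sum>k. ennreal (2 * K / (real (Suc k))\<^sup>2)) \<noteq> top"
      by (rule ennreal_suminf_neq_top[OF sum]) (use K in simp)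
    then show ?thesis
      by (simp only: less_top infinity_ennreal_def)
  qed
  finally have "AE \<omega> in M. (\<Sum>k. ennreal (f k \<omega>)) \<noteq> \<infinity>"
    using f_int by (intro nn_integral_PInf_AE) (auto simp: less_top)
  then show ?thesis
  proof eventually_elim
    case (elim \<omega>)
    then have "summable (\<lambda>k. f k \<omega>)"
      by (intro summable_suminf_not_top) (auto simp: f_nonneg)
    then have "(\<lambda>k. sqrt (f k \<omega>)) \<longlonglongrightarrow> sqrt 0"
      by (intro tendsto_real_sqrt summable_LIMSEQ_zero)
    then have "(\<lambda>k. \<bar>U ((Suc k)\<^sup>2) \<omega> / real ((Suc k)\<^sup>2)\<bar>) \<longlonglongrightarrow> 0"
      by (simp only: f_def real_sqrt_abs real_sqrt_zero)
    then have "(\<lambda>k. U ((Suc k)\<^sup>2) \<omega> / real ((Suc k)\<^sup>2)) \<longlonglongrightarrow> 0"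
      by (rule tendsto_rabs_zero_cancel)
    moreover have "\<bar>U (Suc n) \<omega> - U n \<omega>\<bar> \<le> C" for n
      using d_bound by (simp add: U_Suc)
    ultimately show ?case
      by (intro LIMSEQ_div_from_squares)
  qed
qed

subsection \<open>Unboundedness\<close>

text \<open>The corrector factor is at least 1/2, which leaves a growth of
  \<open>z\<^sup>2 * \<sigma>2 / 4\<close>; the cubic error consumes at most half of it.\<close>

lemma exp_kernel_lower:
  assumes z: "0 \<le> z" "z \<le> 1" "z * C \<le> 1" "rate * z \<le> \<sigma>2 / 8" and \<sigma>: "0 < \<sigma>2"
  shows "1 + z\<^sup>2 / 2 * g k i + z\<^sup>2 * \<sigma>2 / 8
    \<le> (\<Sum>j\<in>UNIV. T k $ i $ j * (exp (z * d k i j) * (1 + z\<^sup>2 / 2 * g (Suc k) j)))"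
proof -
  have "rate * z ^ 3 \<le> z\<^sup>2 * (\<sigma>2 / 8)"
    using mult_left_mono[OF z(4), of "z\<^sup>2"] by (simp add: power2_eq_square power3_eq_cube mult_ac)
  moreover have "z\<^sup>2 * \<sigma>2 / 4 \<le> z\<^sup>2 / 2 * \<sigma>2 * (1 + z\<^sup>2 / 2 * g k i)"
  proof -
    have "z\<^sup>2 \<le> z"
      using z by (simp add: power2_eq_square mult_left_le)
    then have "\<bar>z\<^sup>2 * g k i\<bar> \<le> z * C"
      unfolding abs_mult using g_bound z by (intro mult_mono) auto
    then have "1 / 2 \<le> 1 + z\<^sup>2 / 2 * g k i"
      using z by (simp add: abs_le_iff)
    from mult_left_mono[OF this, of "z\<^sup>2 / 2 * \<sigma>2"] show ?thesis
      using \<sigma> by simp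
  qed
  moreover have "(1 + z\<^sup>2 / 2 * \<sigma>2) * (1 + z\<^sup>2 / 2 * g k i)
      = (1 + z\<^sup>2 / 2 * g k i) + z\<^sup>2 / 2 * \<sigma>2 * (1 + z\<^sup>2 / 2 * g k i)"
    using distrib_right[of 1 "z\<^sup>2 / 2 * \<sigma>2" "1 + z\<^sup>2 / 2 * g k i"] by (simp only: mult_1_left)
  moreover have "(1 + z\<^sup>2 / 2 * \<sigma>2) * (1 + z\<^sup>2 / 2 * g k i) - rate * z ^ 3
      \<le> (\<Sum>j\<in>UNIV. T k $ i $ j * (exp (z * d k i j) * (1 + z\<^sup>2 / 2 * g (Suc k) j)))"
    using exp_kernel[of z k i] z by (simp add: abs_le_iff)
  ultimately show ?thesis
    by linarith
qed

text \<open>Letting \<open>z\<close> tend to \<open>0\<close> turns this into \<open>1 \<le> 1 - prob \<dots>\<close>.\<close>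

lemma prob_bounded_above_le:
  assumes z: "0 < z" "z \<le> 1" "z * C \<le> 1" "rate * z \<le> \<sigma>2 / 8" and \<sigma>: "0 < \<sigma>2" and a: "C \<le> a"
  shows "exp (- (z * C)) * (1 - z * C)
    \<le> exp (z * (a + C)) * (1 + z * C) * (1 - prob {\<omega> \<in> space M. \<forall>k. U k \<omega> \<le> a})"
proof -
  define L where "L = exp (z * (a + C)) * (1 + z * C)"
  \<comment> \<open>The surplus per step from \<open>exp_kernel_lower\<close>, earned on the
    exponential mass \<open>e k\<close> of the paths still below the level.\<close>
  define \<epsilon> where "\<epsilon> = z\<^sup>2 * \<sigma>2 / 8"
  define H :: "nat \<Rightarrow> 'a \<Rightarrow> real" where "H k \<omega> = of_bool (\<forall>j\<le>k. U j \<omega> \<le> a)" for k \<omega>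
  define Y where "Y k u i = exp (z * u) * (1 + z\<^sup>2 / 2 * g k i)" for k u i
  define b where "b k = expectation (\<lambda>\<omega>. H k \<omega> * Y k (U k \<omega>) (X k \<omega>))" for k
  define e where "e k = expectation (\<lambda>\<omega>. H k \<omega> * exp (z * U k \<omega>))" for k
  define h where "h k = expectation (H k)" for k
  let ?p = "prob {\<omega> \<in> space M. \<forall>k. U k \<omega> \<le> a}"
  have \<epsilon>: "0 < \<epsilon>"
    using z \<sigma> by (simp add: \<epsilon>_def)
  have quad: "\<bar>z\<^sup>2 / 2 * g k i\<bar> \<le> z * C" for k i
  proof -
    have "z\<^sup>2 \<le> z"
      using z by (simp add: power2_eq_square mult_left_le)
    then have "z\<^sup>2 / 2 \<le> z"
      using z by simp
    then show ?thesis
      unfolding abs_mult using g_bound z by (intro mult_mono) auto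
  qed
  have q: "0 \<le> 1 + z\<^sup>2 / 2 * g k i" "1 + z\<^sup>2 / 2 * g k i \<le> 1 + z * C" "1 - z * C \<le> 1 + z\<^sup>2 / 2 * g k i" for k i
    using quad[of k i] z(3) unfolding abs_le_iff by linarith+
  have adapted_H: "adapted X k (H k)" for k
  proof (rule adaptedI)
    fix \<omega> \<omega>' assume eq: "\<And>i. i \<le> k \<Longrightarrow> X i \<omega> = X i \<omega>'"
    have "U j \<omega> = U j \<omega>'" if "j \<le> k" for j
      using that by (intro adaptedD[OF U_adapted] eq) simp
    then show "H k \<omega> = H k \<omega>'"
      by (simp add: H_def)
  qed
  have H_nonneg: "0 \<le> H k \<omega>" and H_le: "H k \<omega> \<le> 1" for k \<omega>
    by (simp_all add: H_def)
  have int_b: "integrable M (\<lambda>\<omega>. H k \<omega> * Y k (U k \<omega>) (X k \<omega>))"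
    and int_e: "integrable M (\<lambda>\<omega>. H k \<omega> * exp (z * U k \<omega>))"
    and int_h: "integrable M (H k)" for k
    using integrable_past[OF adapted_H, where f = "\<lambda>h u i. h * Y k u i"]
      integrable_past[OF adapted_H, where f = "\<lambda>h u i. h * exp (z * u)"]
      integrable_past[OF adapted_H, where f = "\<lambda>h u i. h"] by auto
  have int_c: "integrable M (\<lambda>\<omega>. H k \<omega> * Y (Suc k) (U (Suc k) \<omega>) (X (Suc k) \<omega>))" for k
    using integrable_past[OF adapted_mono[OF adapted_H le_SucI[OF order_refl]],
        where f = "\<lambda>h u i. h * Y (Suc k) u i"] by auto
  have Y_le: "Y k u i \<le> L" if "u \<le> a + C" for k u i
    unfolding Y_def L_def using that z q by (intro mult_mono) auto
  txt \<open>\<open>L\<close> bounds \<open>Y\<close> at the first passage above \<open>a\<close>, where the overshoot is at most \<open>C\<close>.\<close>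
  have step: "b k + \<epsilon> * e k \<le> b (Suc k) + L * (h k - h (Suc k))" for k
  proof -
    have "b k + \<epsilon> * e k = expectation (\<lambda>\<omega>. H k \<omega> * Y k (U k \<omega>) (X k \<omega>) + \<epsilon> * (H k \<omega> * exp (z * U k \<omega>)))"
      unfolding b_def e_def using int_b int_e by (subst Bochner_Integration.integral_add) auto
    also have "\<dots> \<le> expectation (\<lambda>\<omega>. \<Sum>j\<in>UNIV. T k $ X k \<omega> $ j *\<^sub>R
        (H k \<omega> * Y (Suc k) (U k \<omega> + d k (X k \<omega>) j) j))"
    proof (rule integral_mono)
      show "integrable M (\<lambda>\<omega>. H k \<omega> * Y k (U k \<omega>) (X k \<omega>) + \<epsilon> * (H k \<omega> * exp (z * U k \<omega>)))"
        using int_b int_e by auto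
      show "integrable M (\<lambda>\<omega>. \<Sum>j\<in>UNIV. T k $ X k \<omega> $ j *\<^sub>R
        (H k \<omega> * Y (Suc k) (U k \<omega> + d k (X k \<omega>) j) j))"
        by (rule integrable_past[OF adapted_H, where f = "\<lambda>h u i. \<Sum>j\<in>UNIV. T k $ i $ j *\<^sub>R
        (h * Y (Suc k) (u + d k i j) j)"])
      fix \<omega>
      let ?i = "X k \<omega>" and ?u = "U k \<omega>"
      have "H k \<omega> * Y k ?u ?i + \<epsilon> * (H k \<omega> * exp (z * ?u))
          = (H k \<omega> * exp (z * ?u)) * (1 + z\<^sup>2 / 2 * g k ?i + z\<^sup>2 * \<sigma>2 / 8)"
        by (simp add: Y_def \<epsilon>_def algebra_simps)
      also have "\<dots> \<le> (H k \<omega> * exp (z * ?u)) *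
          (\<Sum>j\<in>UNIV. T k $ ?i $ j * (exp (z * d k ?i j) * (1 + z\<^sup>2 / 2 * g (Suc k) j)))"
        using z \<sigma> H_nonneg by (intro mult_left_mono exp_kernel_lower) auto
      also have "\<dots> = (\<Sum>j\<in>UNIV. T k $ ?i $ j *\<^sub>R (H k \<omega> * Y (Suc k) (?u + d k ?i j) j))"
        unfolding sum_distrib_left by (intro sum.cong refl) (simp add: Y_def exp_add distrib_left[of z])
      finally show "H k \<omega> * Y k ?u ?i + \<epsilon> * (H k \<omega> * exp (z * ?u))
          \<le> (\<Sum>j\<in>UNIV. T k $ ?i $ j *\<^sub>R (H k \<omega> * Y (Suc k) (?u + d k ?i j) j))" .
    qed
    also have "\<dots> = expectation (\<lambda>\<omega>. H k \<omega> * Y (Suc k) (U (Suc k) \<omega>) (X (Suc k) \<omega>))"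
      by (rule expectation_step[OF adapted_H, where f = "\<lambda>h u j. h * Y (Suc k) u j", symmetric])
    also have "\<dots> \<le> expectation (\<lambda>\<omega>. H (Suc k) \<omega> * Y (Suc k) (U (Suc k) \<omega>) (X (Suc k) \<omega>)
        + L * (H k \<omega> - H (Suc k) \<omega>))"
    proof (rule integral_mono)
      show "integrable M (\<lambda>\<omega>. H (Suc k) \<omega> * Y (Suc k) (U (Suc k) \<omega>) (X (Suc k) \<omega>)
        + L * (H k \<omega> - H (Suc k) \<omega>))"
        using int_b int_h by auto
      fix \<omega>
      show "H k \<omega> * Y (Suc k) (U (Suc k) \<omega>) (X (Suc k) \<omega>)
          \<le> H (Suc k) \<omega> * Y (Suc k) (U (Suc k) \<omega>) (X (Suc k) \<omega>) + L * (H k \<omega> - H (Suc k) \<omega>)"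
      proof (cases "\<forall>j\<le>k. U j \<omega> \<le> a")
        case True
        then have "U (Suc k) \<omega> \<le> a + C"
          using d_bound[of k "X k \<omega>" "X (Suc k) \<omega>"] by (simp add: U_Suc abs_le_iff add_mono)
        then show ?thesis
          using True Y_le by (simp add: H_def le_Suc_eq of_bool_def)
      qed (auto simp: H_def)
    qed (rule int_c)
    also have "\<dots> = b (Suc k) + L * (h k - h (Suc k))"
      unfolding b_def h_def using int_b int_h by simp
    finally show ?thesis .
  qed
  have telescope: "b 0 + \<epsilon> * (\<Sum>k<n. e k) \<le> b n + L * (h 0 - h n)" for n
  proof (induction n)
    case (Suc n)
    then show ?case
      using step[of n] by (simp add: algebra_simps)
  qed simp
  have L: "0 \<le> L"
    using z C_nonneg by (simp add: L_def)
  have e_nonneg: "0 \<le> e k" for k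
    unfolding e_def using H_nonneg by (intro Bochner_Integration.integral_nonneg) auto
  have h_le: "h k \<le> 1" for k
    unfolding h_def using int_h H_le by (intro integral_le_const) auto
  have p_le: "?p \<le> h k" for k
  proof -
    have "?p = expectation (indicator {\<omega> \<in> space M. \<forall>k. U k \<omega> \<le> a})"
      by simp
    also have "\<dots> \<le> h k"
      unfolding h_def using int_h
      by (intro integral_mono integrable_real_indicator) (auto simp: indicator_def H_def less_top[symmetric])
    finally show ?thesis .
  qed
  have b_le: "b k \<le> (1 + z * C) * e k" for k
  proof -
    have "b k \<le> expectation (\<lambda>\<omega>. (1 + z * C) * (H k \<omega> * exp (z * U k \<omega>)))"
      unfolding b_def
    proof (rule integral_mono[OF int_b integrable_mult_right[OF int_e]])
      fix \<omega>
      have "(H k \<omega> * exp (z * U k \<omega>)) * (1 + z\<^sup>2 / 2 * g k (X k \<omega>))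
          \<le> (H k \<omega> * exp (z * U k \<omega>)) * (1 + z * C)"
        using H_nonneg q by (intro mult_left_mono) auto
      then show "H k \<omega> * Y k (U k \<omega>) (X k \<omega>) \<le> (1 + z * C) * (H k \<omega> * exp (z * U k \<omega>))"
        by (simp only: Y_def mult_ac)
    qed
    then show ?thesis
      by (simp add: e_def)
  qed
  have b_le_L: "b k \<le> L" for k
  proof -
    have "H k \<omega> * Y k (U k \<omega>) (X k \<omega>) \<le> L" for \<omega>
      using Y_le[of "U k \<omega>" k "X k \<omega>"] L C_nonneg by (fastforce simp: H_def of_bool_def)
    then show ?thesis
      unfolding b_def using int_b by (intro integral_le_const) auto
  qed
  have "h 0 - h n \<le> 1 - ?p" for n
    using h_le[of 0] p_le[of n] by linarith
  then have main: "b 0 + \<epsilon> * (\<Sum>k<n. e k) \<le> b n + L * (1 - ?p)" for n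
    using telescope[of n] mult_left_mono[OF _ L] by (meson add_left_mono order_trans)
  \<comment> \<open>The total surplus is bounded because \<open>b n\<close> is, so \<open>e\<close>
    is summable. Thus the mass below the level dies out and takes the upper bound
    \<open>(1 + z * C) * e n\<close> for \<open>b n\<close> with it; only the contribution of
    crossing paths survives in the limit.\<close>
  have "(\<Sum>k<n. e k) \<le> (L + L * (1 - ?p) - b 0) / \<epsilon>" for n
    using main[of n] b_le_L[of n] \<epsilon> by (simp add: pos_le_divide_eq mult.commute)
  then have "summable e"
    using e_nonneg by (intro summableI_nonneg_bounded)
  then have "(\<lambda>n. (1 + z * C) * e n + L * (1 - ?p)) \<longlonglongrightarrow> (1 + z * C) * 0 + L * (1 - ?p)"
    by (intro tendsto_add tendsto_mult tendsto_const summable_LIMSEQ_zero)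
  moreover have "b 0 \<le> (1 + z * C) * e n + L * (1 - ?p)" for n
  proof -
    have "0 \<le> \<epsilon> * (\<Sum>k<n. e k)"
      using \<epsilon> e_nonneg by (intro mult_nonneg_nonneg sum_nonneg) auto
    then show ?thesis
      using main[of n] b_le[of n] by linarith
  qed
  ultimately have "b 0 \<le> L * (1 - ?p)"
    using LIMSEQ_le_const[of _ _ "b 0"] by fastforce
  \<comment> \<open>Since \<open>C \<le> a\<close>, every path starts below the level, so
    \<open>H 0\<close> is identically 1.\<close>
  moreover have "exp (- (z * C)) * (1 - z * C) \<le> b 0"
    unfolding b_def
  proof (rule integral_ge_const)
    show "AE \<omega> in M. exp (- (z * C)) * (1 - z * C) \<le> H 0 \<omega> * Y 0 (U 0 \<omega>) (X 0 \<omega>)"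
    proof (rule AE_I2)
      fix \<omega>
      have "- C \<le> U 0 \<omega>" "U 0 \<omega> \<le> a"
        using U_0[of \<omega>] a by (auto simp: abs_le_iff)
      then have "- (z * C) \<le> z * U 0 \<omega>" "H 0 \<omega> = 1"
        using z mult_left_mono[of "- C" "U 0 \<omega>" z] by (auto simp: H_def)
      then show "exp (- (z * C)) * (1 - z * C) \<le> H 0 \<omega> * Y 0 (U 0 \<omega>) (X 0 \<omega>)"
        using q z by (auto simp: Y_def intro!: mult_mono)
    qed
  qed (rule int_b)
  ultimately show ?thesis
    by (simp add: L_def)
qed

lemma prob_bounded_above:
  assumes \<sigma>: "0 < \<sigma>2" and a: "C \<le> a"
  shows "prob {\<omega> \<in> space M. \<forall>k. U k \<omega> \<le> a} = 0"
proof -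
  let ?p = "prob {\<omega> \<in> space M. \<forall>k. U k \<omega> \<le> a}"
  have \<sigma>8: "0 < \<sigma>2 / 8"
    using \<sigma> by simp
  have small: "\<forall>\<^sub>F z in at_right 0. z * K \<le> c" if "0 < c" for K c :: real
  proof -
    have "((\<lambda>z. z * K) \<longlongrightarrow> 0 * K) (at_right 0)"
      by (intro tendsto_intros)
    then show ?thesis
      using order_tendstoD(2)[of "\<lambda>z. z * K" 0 "at_right 0" c] that by (auto elim: eventually_mono)
  qed
  have "((\<lambda>z. exp (- (z * C)) * (1 - z * C)) \<longlongrightarrow> exp (- (0 * C)) * (1 - 0 * C)) (at_right 0)"
    by (intro tendsto_intros)
  moreover have "((\<lambda>z. exp (z * (a + C)) * (1 + z * C) * (1 - ?p))
      \<longlongrightarrow> exp (0 * (a + C)) * (1 + 0 * C) * (1 - ?p)) (at_right 0)"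
    by (intro tendsto_intros)
  moreover have "\<forall>\<^sub>F z in at_right 0. exp (- (z * C)) * (1 - z * C) \<le> exp (z * (a + C)) * (1 + z * C) * (1 - ?p)"
    using eventually_at_right_less[of "0 :: real"] small[OF zero_less_one, of 1]
      small[OF zero_less_one, of C] small[OF \<sigma>8, of rate]
  proof eventually_elim
    case (elim z)
    then show ?case
      using \<sigma> a by (intro prob_bounded_above_le) (auto simp: mult.commute)
  qed
  ultimately have "exp (- (0 * C)) * (1 - 0 * C) \<le> exp (0 * (a + C)) * (1 + 0 * C) * (1 - ?p)"
    by (intro tendsto_le[rotated 1]) auto
  then show ?thesis
    by (simp add: measure_le_0_iff)
qed

lemma unbounded_above:
  assumes \<sigma>: "0 < \<sigma>2"
  shows "AE \<omega> in M. \<forall>a. \<exists>k. a < U k \<omega>"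
proof -
  have "AE \<omega> in M. \<exists>k. C + real n < U k \<omega>" for n
  proof -
    have "prob {\<omega> \<in> space M. \<forall>k. U k \<omega> \<le> C + real n} = 0"
      using \<sigma> by (intro prob_bounded_above) auto
    then have "AE \<omega> in M. \<omega> \<notin> {\<omega> \<in> space M. \<forall>k. U k \<omega> \<le> C + real n}"
      by (subst AE_iff_measurable[OF _ refl]) (auto simp: emeasure_eq_measure)
    then show ?thesis
      using AE_space by eventually_elim (auto simp: not_le)
  qed
  then have "AE \<omega> in M. \<forall>n. \<exists>k. C + real n < U k \<omega>"
    unfolding AE_all_countable by blast
  then show ?thesis
  proof eventually_elim
    case (elim \<omega>)
    show ?case
    proof
      fix a
      obtain n where "a - C < real n"
        using reals_Archimedean2 by blast
      moreover obtain k where "C + real n < U k \<omega>"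
        using elim by blast
      ultimately show "\<exists>k. a < U k \<omega>"
        by (intro exI[of _ k]) linarith
    qed
  qed
qed

end

subsection \<open>Limit theorems for the payoff of a periodic chain\<close>

lemma limsup_eq_PInfty_if_unbounded:
  fixes u :: "nat \<Rightarrow> real"
  assumes "\<And>a. \<exists>k. a < u k"
  shows "limsup (\<lambda>n. ereal (u n)) = \<infinity>"
proof (rule ccontr)
  assume "limsup (\<lambda>n. ereal (u n)) \<noteq> \<infinity>"
  then obtain c :: nat where "limsup (\<lambda>n. ereal (u n)) < ereal (real c)"
    using less_PInf_Ex_of_nat by auto
  then have "\<forall>\<^sub>F n in sequentially. ereal (u n) < ereal (real c)"
    by (rule Limsup_lessD)
  then obtain n0 where n0: "\<And>n. n0 \<le> n \<Longrightarrow> u n < real c"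
    by (auto simp: eventually_sequentially)
  \<comment> \<open>Exceeding \<open>c\<close> somewhere is not enough, as this could happen before
    \<open>n0\<close>. The added sum dominates all those early values.\<close>
  obtain k where k: "real c + (\<Sum>i<n0. \<bar>u i\<bar>) < u k"
    using assms by blast
  show False
  proof (cases "k < n0")
    case True
    then have "\<bar>u k\<bar> \<le> (\<Sum>i<n0. \<bar>u i\<bar>)"
      by (intro member_le_sum) auto
    with k show False
      by (simp add: abs_le_iff)
  next
    case False
    then have "u k < real c"
      by (intro n0) simp
    moreover have "0 \<le> (\<Sum>i<n0. \<bar>u i\<bar>)"
      by (intro sum_nonneg) auto
    ultimately show False
      using k by linarith
  qed
qed

locale periodic_chain =
  inhomogeneous_chain M T X + periodic_kernel N T
  for M :: "'a measure" and N :: nat and T :: "nat \<Rightarrow> real^'n^'n" and X :: "nat \<Rightarrow> 'a \<Rightarrow> 'n"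
begin

definition walk :: "('n \<Rightarrow> 'n \<Rightarrow> real) \<Rightarrow> nat \<Rightarrow> 'a \<Rightarrow> real" where
  "walk w k \<omega> = total_payoff w X k \<omega> - real k * avg (drift w) + poisson (drift w) k $ X k \<omega>"

lemma total_payoff_Suc:
  "total_payoff w X (Suc k) \<omega> = total_payoff w X k \<omega> + w (X k \<omega>) (X (Suc k) \<omega>)"
  by (simp add: total_payoff_def payoff_def)

lemma walk_Suc: "walk w (Suc k) \<omega> = walk w k \<omega> + corrected w k (X k \<omega>) (X (Suc k) \<omega>)"
  by (simp add: walk_def total_payoff_Suc corrected_def algebra_simps)

text \<open>Written as a sum, to fit the form \<open>U n + b n (X n)\<close> of
  \<open>central_limit\<close>.\<close>

lemma total_payoff_eq_walk:
  "total_payoff w X k \<omega> - real k * avg (drift w) = walk w k \<omega> + - (poisson (drift w) k $ X k \<omega>)"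
  by (simp add: walk_def)

lemma adapted_walk: "adapted X k (walk w k)"
proof (induction k)
  case 0
  show ?case
    by (simp add: walk_def adapted_def total_payoff_def)
next
  case (Suc k)
  show ?case
  proof (rule adaptedI)
    fix \<omega> \<omega>' assume eq: "\<And>i. i \<le> Suc k \<Longrightarrow> X i \<omega> = X i \<omega>'"
    then have "walk w k \<omega> = walk w k \<omega>'"
      by (intro adaptedD[OF Suc]) simp
    with eq[of k] eq[of "Suc k"] show "walk w (Suc k) \<omega> = walk w (Suc k) \<omega>'"
      by (simp add: walk_Suc)
  qed
qed

lemma corrected_bounded:
  obtains C where "\<And>k i j. \<bar>corrected w k i j\<bar> \<le> C"
proof -
  have "(\<lambda>(i, j). corrected w (k + N) i j) = (\<lambda>(i, j). corrected w k i j)" for k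
    by (simp add: corrected_periodic)
  then obtain C where "\<bar>(\<lambda>(i, j). corrected w k i j) p\<bar> \<le> C" for k p
    using periodic_bounded[of "\<lambda>k (i, j). corrected w k i j" N] N_pos by metis
  then have "\<bar>corrected w k i j\<bar> \<le> C" for k i j
    by (metis case_prod_conv)
  then show ?thesis
    by (rule that)
qed

lemma poisson_bounded:
  obtains C where "\<And>k i. \<bar>poisson c k $ i\<bar> \<le> C"
  using periodic_bounded[of "\<lambda>k i. poisson c k $ i" N] poisson_periodic N_pos by metis

text \<open>Solving the Poisson equation for \<open>dispersion w\<close> is precisely what
  \<open>g_step\<close> asks for, with \<sigma>2 the average dispersion. At time 0 the walk is just
  \<open>poisson (drift w) 0\<close> at \<open>X 0\<close>, so the common bound covers it as
  well.\<close>

lemma corrected_walk_exists: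
  obtains C where
    "corrected_walk M T X (walk w) (corrected w) (\<lambda>k i. poisson (dispersion w) k $ i) (avg (dispersion w)) C"
    "\<And>k i. \<bar>poisson (drift w) k $ i\<bar> \<le> C"
proof -
  obtain C1 where C1: "\<And>k i j. \<bar>corrected w k i j\<bar> \<le> C1"
    using corrected_bounded[of w] by blast
  obtain C2 where C2: "\<And>k i. \<bar>poisson (drift w) k $ i\<bar> \<le> C2"
    using poisson_bounded[of "drift w"] by blast
  obtain C3 where C3: "\<And>k i. \<bar>poisson (dispersion w) k $ i\<bar> \<le> C3"
    using poisson_bounded[of "dispersion w"] by blast
  define C where "C = max C1 (max C2 C3)"
  have C: "\<bar>corrected w k i j\<bar> \<le> C" "\<bar>poisson (drift w) k $ i\<bar> \<le> C" "\<bar>poisson (dispersion w) k $ i\<bar> \<le> C" for k i j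
    using C1[of k i j] C2[of k i] C3[of k i] unfolding C_def by linarith+
  have g: "(\<Sum>j\<in>UNIV. T k $ i $ j * ((corrected w k i j)\<^sup>2 + poisson (dispersion w) (Suc k) $ j))
      = poisson (dispersion w) k $ i + avg (dispersion w)" for k i
  proof -
    have "poisson (dispersion w) k $ i
        = (T k *v poisson (dispersion w) (Suc k)) $ i + dispersion w k $ i - avg (dispersion w)"
      by (subst poisson_equation[where c = "dispersion w", OF dispersion_periodic]) simp
    then show ?thesis
      by (simp add: dispersion_def matrix_vector_mult_def distrib_left sum.distrib)
  qed
  have "corrected_walk M T X (walk w) (corrected w) (\<lambda>k i. poisson (dispersion w) k $ i) (avg (dispersion w)) C"
  proof
    show "\<bar>walk w 0 \<omega>\<bar> \<le> C" for \<omega>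
      by (simp add: walk_def total_payoff_def C)
  qed (simp_all add: stoch adapted_walk walk_Suc C g corrected_mean)
  then show ?thesis
    using C(2) by (rule that)
qed

lemma payoff_limits:
  fixes w :: "'n \<Rightarrow> 'n \<Rightarrow> real"
  defines "S \<equiv> total_payoff w X" and "m \<equiv> avg (drift w)" and "v \<equiv> avg (dispersion w)"
  shows payoff_mean: "(\<lambda>n. expectation (S n) / real n) \<longlonglongrightarrow> m"
    and payoff_strong_law: "AE \<omega> in M. (\<lambda>n. S n \<omega> / real n) \<longlonglongrightarrow> m"
    and payoff_variance: "0 < v \<Longrightarrow> (\<lambda>n. variance (S n) / real n) \<longlonglongrightarrow> v"
    and payoff_central_limit: "0 < v \<Longrightarrow> weak_conv_m
          (\<lambda>n. distr M borel (\<lambda>\<omega>. (S n \<omega> - real n * m) / sqrt (real n * v))) std_normal_distribution"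
    and payoff_oscillates: "m = 0 \<Longrightarrow> 0 < v \<Longrightarrow>
          AE \<omega> in M. liminf (\<lambda>n. ereal (S n \<omega>)) = - \<infinity> \<and> limsup (\<lambda>n. ereal (S n \<omega>)) = \<infinity>"
proof -
  obtain C where cw: "corrected_walk M T X (walk w) (corrected w) (\<lambda>k i. poisson (dispersion w) k $ i) v C"
    and h_le: "\<And>k i. \<bar>poisson (drift w) k $ i\<bar> \<le> C"
    using corrected_walk_exists unfolding v_def by blast
  interpret W: corrected_walk M T X "walk w" "corrected w" "\<lambda>k i. poisson (dispersion w) k $ i" v C
    by (rule cw)
  define h where "h n \<omega> = poisson (drift w) n $ X n \<omega>" for n \<omega>
  define Y where "Y n \<omega> = S n \<omega> - real n * m" for n \<omega>
  have Y: "Y n \<omega> = walk w n \<omega> + - h n \<omega>" for n \<omega>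
    unfolding Y_def h_def S_def m_def by (rule total_payoff_eq_walk)
  have S: "S n = (\<lambda>\<omega>. real n * m + Y n \<omega>)" for n
    by (simp add: Y_def fun_eq_iff)
  have h_bound: "\<bar>h n \<omega>\<bar> \<le> C" for n \<omega>
    by (simp add: h_def h_le)
  have h_int: "integrable M (h n)" for n
    unfolding h_def by (rule adapted_integrable[OF adapted_state])
  have Y_int: "integrable M (Y n)" for n
    unfolding Y using W.U_integrable h_int by auto
  have Y_sq_int: "integrable M (\<lambda>\<omega>. (Y n \<omega>)\<^sup>2)" for n
    unfolding Y h_def
    by (rule W.integrable_past[where H = "\<lambda>_. ()" and f = "\<lambda>_ u i. (u + - poisson (drift w) n $ i)\<^sup>2"])
       (rule adapted_const)
  have E_S: "expectation (S n) = real n * m + expectation (Y n)" for n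
    unfolding S using Y_int by (simp add: prob_space)
  have E_Y: "\<bar>expectation (Y n)\<bar> \<le> 2 * C" for n
  proof -
    have "expectation (Y n) = expectation (walk w 0) - expectation (h n)"
      unfolding Y using W.U_integrable h_int W.expectation_U[of n] by simp
    moreover have "norm (expectation (walk w 0)) \<le> C"
      using W.U_integrable W.U_0 by (intro W.norm_expectation_le) auto
    moreover have "norm (expectation (h n)) \<le> C"
      using h_int h_bound by (intro W.norm_expectation_le) auto
    ultimately show ?thesis
      by (simp add: abs_le_iff)
  qed
  show "(\<lambda>n. expectation (S n) / real n) \<longlonglongrightarrow> m"
  proof (rule Lim_transform)
    show "(\<lambda>n. m) \<longlonglongrightarrow> m"
      by simp
    have "(\<lambda>n. 2 * C / real n) \<longlonglongrightarrow> 0"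
      by real_asymp
    then show "(\<lambda>n. expectation (S n) / real n - m) \<longlonglongrightarrow> 0"
    proof (rule Lim_null_comparison[rotated])
      show "\<forall>\<^sub>F n in sequentially. norm (expectation (S n) / real n - m) \<le> 2 * C / real n"
        using eventually_gt_at_top[of 0]
      proof eventually_elim
        case (elim n)
        then have "expectation (S n) / real n - m = expectation (Y n) / real n"
          by (simp add: E_S add_divide_distrib)
        then show ?case
          using E_Y[of n] by (simp add: divide_right_mono)
      qed
    qed
  qed
  show "AE \<omega> in M. (\<lambda>n. S n \<omega> / real n) \<longlonglongrightarrow> m"
    using W.strong_law
  proof eventually_elim
    case (elim \<omega>)
    have "(\<lambda>n. h n \<omega> / real n) \<longlonglongrightarrow> 0"
    proof (rule Lim_null_comparison)
      show "\<forall>\<^sub>F n in sequentially. norm (h n \<omega> / real n) \<le> C / real n"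
        using h_bound by (simp add: divide_right_mono)
      show "(\<lambda>n. C / real n) \<longlonglongrightarrow> 0"
        by real_asymp
    qed
    with elim have "(\<lambda>n. walk w n \<omega> / real n - h n \<omega> / real n + m) \<longlonglongrightarrow> 0 - 0 + m"
      by (intro tendsto_intros)
    moreover have "\<forall>\<^sub>F n in sequentially. walk w n \<omega> / real n - h n \<omega> / real n + m = S n \<omega> / real n"
      using eventually_gt_at_top[of 0]
      by eventually_elim (simp add: S Y add_divide_distrib diff_divide_distrib)
    ultimately show ?case
      using tendsto_cong by fastforce
  qed
  show "(\<lambda>n. variance (S n) / real n) \<longlonglongrightarrow> v" if v: "0 < v"
  proof (rule Lim_transform)
    define K where "K = C\<^sup>2 + 2 * C"
    \<comment> \<open>The square root and one \<open>C\<^sup>2\<close> bound the difference between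
      the second moments of \<open>Y n\<close> and of the walk, \<open>4 * C\<^sup>2\<close> bounds
      the squared mean of \<open>Y n\<close>, and \<open>K\<close> is the error of
      \<open>second_moment\<close>. Only the rate o(n) matters.\<close>
    define D where "D n = 2 * C * sqrt (real n * v + K) + 5 * C\<^sup>2 + K" for n
    have K: "0 \<le> K"
      using W.C_nonneg by (simp add: K_def)
    have bound: "\<bar>variance (S n) - real n * v\<bar> \<le> D n" for n
    proof -
      let ?U = "\<lambda>\<omega>. (walk w n \<omega>)\<^sup>2"
      have var: "variance (S n) = expectation (\<lambda>\<omega>. (Y n \<omega>)\<^sup>2) - (expectation (Y n))\<^sup>2"
        using variance_eq[OF Y_int Y_sq_int] unfolding E_S unfolding S by simp
      have U2: "\<bar>expectation ?U - real n * v\<bar> \<le> K"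
        using W.second_moment[of n] by (simp add: K_def)
      have abs_int: "integrable M (\<lambda>\<omega>. \<bar>walk w n \<omega>\<bar>)"
        using W.U_integrable by simp
      \<comment> \<open>Cauchy-Schwarz, obtained from the nonnegativity of a variance.\<close>
      have "(expectation (\<lambda>\<omega>. \<bar>walk w n \<omega>\<bar>))\<^sup>2 \<le> expectation ?U"
        using variance_eq[OF abs_int] variance_positive[of "\<lambda>\<omega>. \<bar>walk w n \<omega>\<bar>"] W.U_square_integrable[of n]
        by simp
      also have "\<dots> \<le> real n * v + K"
        using U2 by (simp add: abs_le_iff)
      finally have E_abs: "expectation (\<lambda>\<omega>. \<bar>walk w n \<omega>\<bar>) \<le> sqrt (real n * v + K)"
        by (rule real_le_rsqrt)
      have "expectation (\<lambda>\<omega>. (Y n \<omega>)\<^sup>2) - expectation ?U = expectation (\<lambda>\<omega>. (Y n \<omega>)\<^sup>2 - ?U \<omega>)"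
        using Y_sq_int W.U_square_integrable by simp
      also have "\<bar>\<dots>\<bar> \<le> expectation (\<lambda>\<omega>. 2 * C * \<bar>walk w n \<omega>\<bar> + C\<^sup>2)"
      proof (rule order_trans[OF integral_abs_bound integral_mono])
        fix \<omega>
        have "\<bar>h n \<omega>\<bar> * \<bar>walk w n \<omega>\<bar> \<le> C * \<bar>walk w n \<omega>\<bar>"
          using h_bound by (intro mult_right_mono) auto
        moreover have "(h n \<omega>)\<^sup>2 \<le> C\<^sup>2"
          using h_bound[of n \<omega>] by (simp add: abs_le_square_iff[symmetric] W.C_nonneg)
        moreover have "(Y n \<omega>)\<^sup>2 - ?U \<omega> = (h n \<omega>)\<^sup>2 - 2 * (h n \<omega> * walk w n \<omega>)"
          by (simp add: Y power2_eq_square algebra_simps)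
        moreover have "\<bar>h n \<omega> * walk w n \<omega>\<bar> = \<bar>h n \<omega>\<bar> * \<bar>walk w n \<omega>\<bar>"
          by (rule abs_mult)
        ultimately show "\<bar>(Y n \<omega>)\<^sup>2 - ?U \<omega>\<bar> \<le> 2 * C * \<bar>walk w n \<omega>\<bar> + C\<^sup>2"
          using zero_le_power2[of "h n \<omega>"] by (simp only: abs_le_iff) linarith
      qed (use Y_sq_int W.U_square_integrable abs_int in auto)
      also have "\<dots> = 2 * C * expectation (\<lambda>\<omega>. \<bar>walk w n \<omega>\<bar>) + C\<^sup>2"
        using abs_int by (simp add: prob_space)
      also have "\<dots> \<le> 2 * C * sqrt (real n * v + K) + C\<^sup>2"
        using E_abs W.C_nonneg by (intro add_mono mult_left_mono) auto
      finally have Y2: "\<bar>expectation (\<lambda>\<omega>. (Y n \<omega>)\<^sup>2) - expectation ?U\<bar> \<le> 2 * C * sqrt (real n * v + K) + C\<^sup>2" .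
      have "\<bar>expectation (Y n)\<bar>\<^sup>2 \<le> (2 * C)\<^sup>2"
        using E_Y by (intro power_mono) auto
      then have "(expectation (Y n))\<^sup>2 \<le> 4 * C\<^sup>2"
        by (simp add: power_mult_distrib)
      then show ?thesis
        using Y2 U2 zero_le_power2[of "expectation (Y n)"] unfolding var D_def abs_le_iff by linarith
    qed
    show "(\<lambda>n. v) \<longlonglongrightarrow> v"
      by simp
    have "(\<lambda>n. D n / real n) \<longlonglongrightarrow> 0"
      unfolding D_def using v K by real_asymp
    then show "(\<lambda>n. variance (S n) / real n - v) \<longlonglongrightarrow> 0"
    proof (rule Lim_null_comparison[rotated])
      show "\<forall>\<^sub>F n in sequentially. norm (variance (S n) / real n - v) \<le> D n / real n"
        using eventually_gt_at_top[of 0]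
      proof eventually_elim
        case (elim n)
        then have "variance (S n) / real n - v = (variance (S n) - real n * v) / real n"
          by (simp add: diff_divide_distrib)
        then show ?case
          using bound[of n] by (simp add: divide_right_mono)
      qed
    qed
  qed
  show "weak_conv_m (\<lambda>n. distr M borel (\<lambda>\<omega>. (S n \<omega> - real n * m) / sqrt (real n * v)))
      std_normal_distribution" if "0 < v"
    unfolding S_def m_def total_payoff_eq_walk
    using that h_le by (intro W.central_limit[where b = "\<lambda>n i. - poisson (drift w) n $ i"]) auto
  show "AE \<omega> in M. liminf (\<lambda>n. ereal (S n \<omega>)) = - \<infinity> \<and> limsup (\<lambda>n. ereal (S n \<omega>)) = \<infinity>"
    if m: "m = 0" and v: "0 < v"
  proof -
    \<comment> \<open>Negation preserves centredness and the squared increments, so the same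
      corrector and the same \<sigma>2 fit; unboundedness above of the negated walk gives the lower
      limit.\<close>
    interpret W': corrected_walk M T X "\<lambda>n \<omega>. - walk w n \<omega>" "\<lambda>k i j. - corrected w k i j"
      "\<lambda>k i. poisson (dispersion w) k $ i" v C
    proof
      show "adapted X k (\<lambda>\<omega>. - walk w k \<omega>)" for k
        by (rule adapted_comp[OF adapted_walk])
    qed (use W.U_0 W.d_bound W.g_bound W.g_step in
      \<open>simp_all add: stoch walk_Suc corrected_mean sum_negf\<close>)
    show ?thesis
      using W.unbounded_above[OF v] W'.unbounded_above[OF v]
    proof eventually_elim
      case (elim \<omega>)
      have S0: "S n \<omega> = walk w n \<omega> - h n \<omega>" for n
        by (simp add: S Y m)
      have "\<exists>k. a < S k \<omega>" for a
      proof -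
        obtain k where "a + C < walk w k \<omega>"
          using elim(1) by blast
        then show ?thesis
          using h_bound[of k \<omega>] by (intro exI[of _ k]) (simp add: S0 abs_le_iff)
      qed
      then have "limsup (\<lambda>n. ereal (S n \<omega>)) = \<infinity>"
        by (rule limsup_eq_PInfty_if_unbounded)
      moreover have "\<exists>k. a < - S k \<omega>" for a
      proof -
        obtain k where "a + C < - walk w k \<omega>"
          using elim(2) by blast
        then show ?thesis
          using h_bound[of k \<omega>] by (intro exI[of _ k]) (simp add: S0 abs_le_iff)
      qed
      then have "limsup (\<lambda>n. ereal (- S n \<omega>)) = \<infinity>"
        by (rule limsup_eq_PInfty_if_unbounded)
      then have "- liminf (\<lambda>n. ereal (S n \<omega>)) = \<infinity>"
        using ereal_Limsup_uminus[of sequentially "\<lambda>n. ereal (S n \<omega>)"] by simp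
      then have "liminf (\<lambda>n. ereal (S n \<omega>)) = - \<infinity>"
        by (metis ereal_uminus_uminus)
      ultimately show ?case
        by simp
    qed
  qed
qed

end

theorem theorem6:
  fixes r s :: nat
    and PA PB :: "real^'n^'n"
    and w :: "'n \<Rightarrow> 'n \<Rightarrow> real"
    and M :: "'a measure"
    and X :: "nat \<Rightarrow> 'a \<Rightarrow> 'n"
    and S :: "nat \<Rightarrow> 'a \<Rightarrow> real"
    and \<mu> \<sigma>2 :: real
  assumes "r \<ge> 1" and "s \<ge> 1"
    and "stochastic PA" and "stochastic PB"
    and "irreducible_matrix PA" and "aperiodic PA"
    and "irreducible_matrix PB" and "aperiodic PB"
    and "\<And>k. k < r \<Longrightarrow> irreducible_matrix (PA ^^^ (r - k) ** PB ^^^ s ** PA ^^^ k)"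
    and "\<And>k. k < r \<Longrightarrow> aperiodic (PA ^^^ (r - k) ** PB ^^^ s ** PA ^^^ k)"
    and "\<And>k. k < s \<Longrightarrow> irreducible_matrix (PB ^^^ (s - k) ** PA ^^^ r ** PB ^^^ k)"
    and "\<And>k. k < s \<Longrightarrow> aperiodic (PB ^^^ (s - k) ** PA ^^^ r ** PB ^^^ k)"
    and "prob_space M"
    and "markov_chain M (pattern_matrix r s PA PB) X"
  defines "S \<equiv> total_payoff w X"
    and "\<mu> \<equiv> mean_param r s PA PB w"
    and "\<sigma>2 \<equiv> var_param r s PA PB w"
  shows "((\<lambda>n. prob_space.expectation M (S n) / real n) \<longlonglongrightarrow> \<mu>) \<and>
         (AE \<omega> in M. (\<lambda>n. S n \<omega> / real n) \<longlonglongrightarrow> \<mu>) \<and>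
         (\<sigma>2 > 0 \<longrightarrow>
            ((\<lambda>n. prob_space.variance M (S n) / real n) \<longlonglongrightarrow> \<sigma>2) \<and>
            weak_conv_m
              (\<lambda>n. distr M borel (\<lambda>\<omega>. (S n \<omega> - real n * \<mu>) / sqrt (real n * \<sigma>2)))
              std_normal_distribution) \<and>
         (\<mu> = 0 \<and> \<sigma>2 > 0 \<longrightarrow>
            (AE \<omega> in M.
               - \<infinity> = liminf (\<lambda>n. ereal (S n \<omega>)) \<and>
               liminf (\<lambda>n. ereal (S n \<omega>)) < limsup (\<lambda>n. ereal (S n \<omega>)) \<and>
               limsup (\<lambda>n. ereal (S n \<omega>)) = \<infinity>))"
proof -
  interpret prob_space M
    by fact
  \<comment> \<open>The rotation with \<open>k = 0\<close> is the cycle matrix itself, as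
    \<open>PA ^^^ 0\<close> is the identity.\<close>
  have irred: "irreducible_matrix (PA ^^^ r ** PB ^^^ s)"
    using assms(9)[of 0] \<open>r \<ge> 1\<close> by simp
  interpret A: two_matrix_pattern r s PA PB
    by unfold_locales (fact | rule irred)+
  interpret B: periodic_chain M "r + s" "pattern_matrix r s PA PB" X
    by unfold_locales fact
  have \<mu>: "\<mu> = A.avg (A.drift w)" and \<sigma>: "\<sigma>2 = A.avg (A.dispersion w)"
    by (simp_all add: \<mu>_def \<sigma>2_def A.avg_drift_eq_mean_param A.avg_dispersion_eq_var_param)
  note limits = B.payoff_limits[of w, folded \<mu> \<sigma> S_def]
  show ?thesis
  proof (intro conjI impI)
    assume "\<mu> = 0 \<and> \<sigma>2 > 0"
    then have "AE \<omega> in M. liminf (\<lambda>n. ereal (S n \<omega>)) = - \<infinity> \<and> limsup (\<lambda>n. ereal (S n \<omega>)) = \<infinity>"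
      using limits(5) by simp
    then show "AE \<omega> in M. - \<infinity> = liminf (\<lambda>n. ereal (S n \<omega>)) \<and>
               liminf (\<lambda>n. ereal (S n \<omega>)) < limsup (\<lambda>n. ereal (S n \<omega>)) \<and>
               limsup (\<lambda>n. ereal (S n \<omega>)) = \<infinity>"
      by eventually_elim simp
  qed (use limits(1-4) in simp_all)
qed

end
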